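(* Suppose that there exists a unit $n$-sphere fibration of an open subset $E \subset \mathbb{R}^d$. Then $d \geq 2n+1$, and if $d = 2n+1$, then the spheres are pairwise linked.
   Context: Here $n \ge 0$ and $d \ge 1$ are integers. A unit $n$-sphere in $\mathbb{R}^d$ is a round $n$-dimensional sphere of radius $1$, i.e. a set of the form $\{x \in P : |x-c| = 1\}$ where $P \subset \mathbb{R}^d$ is an affine $(n+1)$-plane and $c \in P$ (its center). A unit $n$-sphere fibration of an open set $E \subset \mathbb{R}^d$ is a decomposition of $E$ as a union of pairwise disjoint unit $n$-spheres (the fibers) that is continuous, meaning that the map taking $p \in E$ to the fiber containing it is continuous; that is, the centers of the spheres and their normal spaces (for a fiber contained in the affine $(n+1)$-plane $P$, the linear $(d-n-1)$-plane orthogonal to $P$) vary continuously with $p$. "The spheres" in the claim are the fibers of the fibration. Two disjoint topological $n$-spheres $S_1$ and $S_2$ in $\mathbb{R}^d$ are linked if $S_1$ is nontrivial as an element of $\pi_n(\mathbb{R}^d - S_2)$. The spheres are pairwise linked if any two distinct fibers are linked.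
   Formalization: E is assumed nonempty, and for d = 2n+1 linking is claimed for distinct fibers in the same connected component of the space of fibers (all fibers if E is connected); for disconnected E it can fail: n=0, d=1, fibers {x,x+2} with x in (0,1) or (10,11). *)

theory Defs
  imports "HOL-Analysis.Analysis"
begin

text \<open>
  The round unit sphere of dimension \<open>n\<close> with centre \<open>c\<close> in the affine \<open>(n+1)\<close>-plane \<open>P\<close>.
  For \<open>n = 0\<close> this is a pair of points at distance 2.
\<close>
definition is_unit_sphere :: "nat \<Rightarrow> 'a::euclidean_space set \<Rightarrow> 'a \<Rightarrow> 'a set \<Rightarrow> bool" where
  "is_unit_sphere n P c S \<longleftrightarrow>
     affine P \<and> aff_dim P = int n + 1 \<and> c \<in> P \<and> S = {x \<in> P. norm (x - c) = 1}"

definition normal_subspace :: "'a::euclidean_space set \<Rightarrow> 'a set" where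
  "normal_subspace P = {v. \<forall>x\<in>P. \<forall>y\<in>P. orthogonal v (x - y)}"

text \<open>
  Continuity of a map from \<open>E\<close> to a Grassmannian.  The Grassmannian carries the topology that it
  inherits by sending a linear subspace to its orthogonal projection; for a linear subspace \<open>V\<close>
  this projection is \<open>closest_point V\<close>.  In finite dimension pointwise continuity of a family of
  linear maps is the same as continuity for the operator norm.
\<close>
definition continuous_subspaces_on :: "'a::euclidean_space set \<Rightarrow> ('a \<Rightarrow> 'a set) \<Rightarrow> bool" where
  "continuous_subspaces_on E N \<longleftrightarrow>
     (\<forall>p\<in>E. subspace (N p)) \<and> (\<forall>v. continuous_on E (\<lambda>p. closest_point (N p) v))"

text \<open>
  \<open>F\<close> is the set of fibres.  A unit sphere determines its plane (its affine hull) and its centre,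
  so on \<open>E\<close> the functions \<open>P\<close> and \<open>c\<close> are determined by \<open>F\<close>.
\<close>
definition unit_sphere_fibration :: "nat \<Rightarrow> 'a::euclidean_space set \<Rightarrow> 'a set set \<Rightarrow> bool" where
  "unit_sphere_fibration n E F \<longleftrightarrow>
     open E \<and> \<Union>F = E \<and> disjoint F \<and> (\<forall>S\<in>F. \<exists>P c. is_unit_sphere n P c S) \<and>
     (\<exists>P c. (\<forall>S\<in>F. \<forall>p\<in>S. is_unit_sphere n (P p) (c p) S) \<and>
            continuous_on E c \<and>
            continuous_subspaces_on E (\<lambda>p. normal_subspace (P p)))"

text \<open>
  Linking of two disjoint topological \<open>n\<close>-spheres \<open>S\<close> and \<open>T\<close>: a parametrisation
  \<open>f\<close> of \<open>S\<close> by the standard \<open>n\<close>-sphere, based at \<open>b\<close>, represents a nontrivial element of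
  the homotopy group \<open>\<pi>\<^sub>n(- T, f b)\<close>, that is, it is not homotopic relative to the
  base point to the constant map.  Whether this holds does not depend on the choice of \<open>f\<close> and
  \<open>b\<close>: two parametrisations differ by a self-homeomorphism of the sphere, and being based
  null-homotopic is the same as being freely null-homotopic.
\<close>
definition linked :: "nat \<Rightarrow> 'a::euclidean_space set \<Rightarrow> 'a set \<Rightarrow> bool" where
  "linked n S T \<longleftrightarrow>
     disjnt S T \<and>
     nsphere n homeomorphic_space top_of_set S \<and>
     nsphere n homeomorphic_space top_of_set T \<and>
     (\<forall>f b. homeomorphic_map (nsphere n) (top_of_set S) f \<and> b \<in> topspace (nsphere n) \<longrightarrow>
        \<not> homotopic_with (\<lambda>h. h b = f b) (nsphere n) (top_of_set (- T)) f (\<lambda>_. f b))"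

text \<open>
  The base of a fibration of an open set: the set of fibres with the quotient topology.
  It is used to state linking for fibres in one component of the base.  Some such restriction is
  unavoidable: the unit circles that are Villarceau circles of the tori of revolution with core
  radius 1 and tube radius in \<open>(0,1)\<close>, together with the core circle, fibre an open solid torus
  in 3-space; its union with a distant translate is again fibred, but fibres in different copies
  are not linked.
\<close>
definition fibre_space :: "'a::euclidean_space set set \<Rightarrow> 'a set topology" where
  "fibre_space F = topology (\<lambda>U. U \<subseteq> F \<and> open (\<Union>U))"

lemma openin_fibre_space:
  assumes "disjoint F"
  shows "openin (fibre_space F) U \<longleftrightarrow> U \<subseteq> F \<and> open (\<Union>U)"
proof -
  have "\<Union>(U \<inter> V) = \<Union>U \<inter> \<Union>V" if UV: "U \<subseteq> F" "V \<subseteq> F" for U V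
  proof
    show "\<Union>(U \<inter> V) \<subseteq> \<Union>U \<inter> \<Union>V" by blast
    show "\<Union>U \<inter> \<Union>V \<subseteq> \<Union>(U \<inter> V)"
    proof
      fix x assume "x \<in> \<Union>U \<inter> \<Union>V"
      then obtain S T where ST: "S \<in> U" "x \<in> S" "T \<in> V" "x \<in> T" by blast
      then have "S = T" using assms UV by (auto simp: pairwise_def disjnt_iff)
      with ST show "x \<in> \<Union>(U \<inter> V)" by blast
    qed
  qed
  moreover have "open (\<Union>(\<Union>K))" if "\<forall>U\<in>K. U \<subseteq> F \<and> open (\<Union>U)" for K
  proof -
    have "\<Union>(\<Union>K) = (\<Union>U\<in>K. \<Union>U)" by blast
    then show ?thesis using that by auto
  qed
  ultimately have "istopology (\<lambda>U. U \<subseteq> F \<and> open (\<Union>U))"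
    unfolding istopology_def by (auto simp: open_Int)
  then show ?thesis by (simp add: fibre_space_def topology_inverse')
qed

lemma topspace_fibre_space:
  assumes "unit_sphere_fibration n E F"
  shows "topspace (fibre_space F) = F"
proof -
  have "disjoint F" "open (\<Union>F)" using assms by (auto simp: unit_sphere_fibration_def)
  then have "openin (fibre_space F) U \<longleftrightarrow> U \<subseteq> F \<and> open (\<Union>U)" "openin (fibre_space F) F" for U
    by (auto simp: openin_fibre_space)
  then show ?thesis unfolding topspace_def by blast
qed

lemma empty_not_fibre:
  fixes E :: "'a::euclidean_space set"
  assumes "unit_sphere_fibration n E F"
  shows "{} \<notin> F"
proof
  assume "{} \<in> F"
  moreover have "\<forall>S\<in>F. \<exists>P c. is_unit_sphere n P c S"
    using assms by (simp add: unit_sphere_fibration_def)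
  ultimately have "\<exists>P c. is_unit_sphere n P c ({} :: 'a set)" by (rule bspec[rotated])
  then obtain P c where "is_unit_sphere n P c ({} :: 'a set)" by (elim exE)
  then have P: "affine P" "aff_dim P = int n + 1" "c \<in> P" and ne: "\<And>x. x \<in> P \<Longrightarrow> norm (x - c) \<noteq> 1"
    by (auto simp: is_unit_sphere_def)
  have "P \<noteq> {c}" using P(2) by auto
  then obtain y where y: "y \<in> P" "y \<noteq> c" using P(3) by blast
  define t where "t = 1 / norm (y - c)"
  have "(1 - t) *\<^sub>R c + t *\<^sub>R y \<in> P" using P(1,3) y(1) by (simp add: affine_alt)
  moreover have "(1 - t) *\<^sub>R c + t *\<^sub>R y - c = t *\<^sub>R (y - c)" by (simp add: algebra_simps)
  then have "norm ((1 - t) *\<^sub>R c + t *\<^sub>R y - c) = 1" using y by (simp add: t_def)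
  ultimately show False using ne by blast
qed

text \<open>For connected \<open>E\<close> all fibres lie in one component of the base.\<close>
lemma connected_component_of_fibre_space:
  assumes fib: "unit_sphere_fibration n E F" and "connected E" and "S \<in> F" "T \<in> F"
  shows "connected_component_of (fibre_space F) S T"
proof -
  have dj: "disjoint F" and E: "\<Union>F = E" using fib by (auto simp: unit_sphere_fibration_def)
  have "connected_space (fibre_space F)"
    unfolding connected_space_def
  proof (rule notI, elim exE conjE)
    fix A B
    assume "openin (fibre_space F) A" "openin (fibre_space F) B"
      and cov: "topspace (fibre_space F) \<subseteq> A \<union> B" and AB: "A \<inter> B = {}" "A \<noteq> {}" "B \<noteq> {}"
    then have op: "A \<subseteq> F" "open (\<Union>A)" "B \<subseteq> F" "open (\<Union>B)"
      by (auto simp: openin_fibre_space[OF dj])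
    have "E \<subseteq> \<Union>A \<union> \<Union>B" using cov E by (auto simp: topspace_fibre_space[OF fib])
    moreover have "\<Union>A \<inter> \<Union>B \<inter> E = {}"
    proof -
      have False if "S \<in> A" "x \<in> S" "T \<in> B" "x \<in> T" for S T x
      proof -
        have "S = T"
          using that dj subsetD[OF op(1)] subsetD[OF op(3)] by (auto simp: pairwise_def disjnt_iff)
        then show False using that AB(1) by blast
      qed
      then show ?thesis by blast
    qed
    moreover have "\<Union>U \<inter> E \<noteq> {}" if U: "U \<subseteq> F" "U \<noteq> {}" for U
    proof -
      obtain S where S: "S \<in> U" "S \<in> F" using U by blast
      then obtain x where "x \<in> S" using empty_not_fibre[OF fib] by (cases "S = {}") auto
      with S show ?thesis using E by blast
    qed
    then have "\<Union>A \<inter> E \<noteq> {}" "\<Union>B \<inter> E \<noteq> {}" using op AB by simp_all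
    ultimately show False using \<open>connected E\<close> op unfolding connected_def by blast
  qed
  then show ?thesis
    using assms by (simp add: connected_space_iff_connected_component topspace_fibre_space[OF fib])
qed

end

theory Submission
  imports Defs
begin

text \<open>
  For two round unit spheres \<open>S\<close>, \<open>T\<close> with planes \<open>P\<close>, \<open>P'\<close> and centres \<open>c\<close>, \<open>c'\<close>, call
  \<open>x \<in> P \<inter> P'\<close> a crossing point if it is equidistant from the two centres and at distance
  less than 1 from them.  The crossing points are the zeros, inside the open unit ball of
  \<open>P\<close>, of the map \<open>x \<mapsto> (|x - c'|\<^sup>2 - |x - c|\<^sup>2, normal part of x - c')\<close>, and this map is
  \<^emph>\<open>affine\<close>.  On \<open>S\<close> itself, where \<open>|x - c| = 1\<close>, its zeros are exactly the points of \<open>S \<inter> T\<close>.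

  If \<open>S\<close> and \<open>T\<close> are disjoint and have a crossing point \<open>x\<close>, then the affine map is injective
  on \<open>P\<close>: otherwise a line of zeros through \<open>x\<close> would leave the unit ball through a point of
  \<open>S \<inter> T\<close>.  An injective linear map from the \<open>n + 1\<close> dimensional direction space of \<open>P\<close> to the
  space \<open>\<real> \<times> P'\<^sup>\<bottom>\<close> of dimension \<open>d - n\<close> forces \<open>d \<ge> 2 n + 1\<close>.  If \<open>d = 2 n + 1\<close> it is an
  isomorphism.  The map \<open>y \<mapsto> (|y - c'|\<^sup>2 - 1, normal part of y - c')\<close> has no zero off \<open>T\<close> and
  agrees with the affine map on \<open>S\<close>; followed by the inverse of the affine map
  and by radial projection from \<open>x\<close> it is a retraction of the complement of \<open>T\<close> onto \<open>S\<close>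
  (\<open>crossing_imp_retract\<close>).  As \<open>S\<close> is not contractible, \<open>S\<close> and \<open>T\<close> are linked.

  It remains to find crossing points.  Arbitrarily close to every point \<open>p\<close> of a fibre \<open>S\<close> there is
  a point of another fibre that has a crossing point with \<open>S\<close> (\<open>fibre_near_slice_crosses\<close>): as
  \<open>q = p + w\<close> runs over a small sphere in the slice normal to \<open>S\<close> at \<open>p\<close>, the affine map of \<open>S\<close>
  and the fibre of \<open>q\<close> takes at \<open>p\<close> a value close to a linear isomorphism of \<open>w\<close>, hence
  an essential map into the nonzero vectors, but at the centre of \<open>S\<close> it takes values in a
  half-space, hence an inessential map.  Some value on the segment from
  the centre to \<open>p\<close> must therefore vanish.  This proves the bound on the dimension.

  Let \<open>d = 2 n + 1\<close>.  Having a crossing point with \<open>S\<close> is a closed condition on the other fibre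
  (\<open>closedin_crosses\<close>), and away from \<open>S\<close> an open one (\<open>crosses_stable\<close>), since
  isomorphisms are stable under perturbation.  For \<open>n \<ge> 1\<close> a punctured ball in the slice is
  connected, so all of its points satisfy the condition; for \<open>n = 0\<close> midpoints of centres are crossing
  points.  Hence the fibres that have a crossing point with \<open>S\<close> form an open and closed set of
  fibres that contains \<open>S\<close>, and so the whole component of \<open>S\<close>.
\<close>

section \<open>Orthogonal projection to a subspace\<close>

lemma closest_point_subspace_eqI:
  fixes N :: "'a::euclidean_space set"
  assumes N: "subspace N" and y: "y \<in> N" and orth: "\<And>z. z \<in> N \<Longrightarrow> (v - y) \<bullet> z = 0"
  shows "closest_point N v = y"
proof -
  have "dist v y \<le> dist v z" if z: "z \<in> N" for z
  proof -
    have "(v - y) \<bullet> (y - z) = 0"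
      by (rule orth[OF subspace_diff[OF N y z]])
    then have "(norm ((v - y) + (y - z)))\<^sup>2 = (norm (v - y))\<^sup>2 + (norm (y - z))\<^sup>2"
      by (intro norm_add_Pythagorean) (simp add: orthogonal_def)
    moreover have "v - z = (v - y) + (y - z)" by simp
    ultimately have "(norm (v - y))\<^sup>2 \<le> (norm (v - z))\<^sup>2"
      by (metis le_add_same_cancel1 zero_le_power2)
    then show ?thesis
      unfolding dist_norm by (rule power2_le_imp_le) simp
  qed
  then show ?thesis
    using closest_point_unique[OF subspace_imp_convex[OF N] closed_subspace[OF N] y, of v] by blast
qed

lemma closest_point_subspace:
  fixes N :: "'a::euclidean_space set"
  assumes N: "subspace N"
  shows closest_point_subspace_mem: "closest_point N v \<in> N"
    and closest_point_subspace_orthogonal: "z \<in> N \<Longrightarrow> (v - closest_point N v) \<bullet> z = 0"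
proof -
  have sp: "span N = N" using N by (simp add: span_eq_iff)
  obtain y w where yw: "y \<in> N" "\<And>z. z \<in> N \<Longrightarrow> orthogonal w z" "v = y + w"
    using orthogonal_subspace_decomp_exists[of N v] unfolding sp by blast
  have "closest_point N v = y"
    by (rule closest_point_subspace_eqI[OF N yw(1)]) (use yw(2,3) in \<open>simp add: orthogonal_def\<close>)
  then show "closest_point N v \<in> N" and "z \<in> N \<Longrightarrow> (v - closest_point N v) \<bullet> z = 0"
    using yw by (simp_all add: orthogonal_def)
qed

lemma linear_closest_point_subspace:
  fixes N :: "'a::euclidean_space set"
  assumes N: "subspace N"
  shows "linear (closest_point N)"
proof (rule linearI)
  note mem = closest_point_subspace_mem[OF N] and orth = closest_point_subspace_orthogonal[OF N]
  fix v w :: 'a and r :: real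
  show "closest_point N (v + w) = closest_point N v + closest_point N w"
  proof (rule closest_point_subspace_eqI[OF N subspace_add[OF N mem mem]])
    fix z assume z: "z \<in> N"
    show "(v + w - (closest_point N v + closest_point N w)) \<bullet> z = 0"
      using orth[OF z, of v] orth[OF z, of w] by (simp add: inner_diff_left inner_add_left)
  qed
  show "closest_point N (r *\<^sub>R v) = r *\<^sub>R closest_point N v"
  proof (rule closest_point_subspace_eqI[OF N subspace_scale[OF N mem]])
    fix z assume z: "z \<in> N"
    show "(r *\<^sub>R v - r *\<^sub>R closest_point N v) \<bullet> z = 0"
      using orth[OF z, of v] by (simp add: inner_diff_left)
  qed
qed

lemma inner_closest_point_subspace:
  fixes N :: "'a::euclidean_space set"
  assumes N: "subspace N"
  shows "v \<bullet> closest_point N w = closest_point N v \<bullet> closest_point N w"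
  using closest_point_subspace_orthogonal[OF N closest_point_subspace_mem[OF N], of v w]
  by (simp add: inner_diff_left)

section \<open>Planes, their directions and their normal spaces\<close>

definition direction :: "'a::euclidean_space set \<Rightarrow> 'a set" where
  "direction P = {x - y | x y. x \<in> P \<and> y \<in> P}"

lemma direction_conv_image:
  assumes "affine P" "c \<in> P"
  shows "direction P = (\<lambda>x. x - c) ` P"
proof
  show "direction P \<subseteq> (\<lambda>x. x - c) ` P"
  proof
    fix u assume "u \<in> direction P"
    then obtain x y where xy: "x \<in> P" "y \<in> P" "u = x - y" by (auto simp: direction_def)
    have "x + 1 *\<^sub>R (c - y) \<in> P"
      using mem_affine_3_minus[OF assms(1), of x c y 1] xy assms(2) by simp
    then show "u \<in> (\<lambda>x. x - c) ` P" using xy(3) by (intro image_eqI[where x="x + (c - y)"]) auto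
  qed
qed (use assms(2) in \<open>auto simp: direction_def\<close>)

lemma mem_plane_iff_direction:
  assumes "affine P" "c \<in> P"
  shows "x \<in> P \<longleftrightarrow> x - c \<in> direction P"
  unfolding direction_conv_image[OF assms] by (auto simp: image_iff)

lemma plane_add_direction:
  assumes "affine P" "c \<in> P" "u \<in> direction P"
  shows "c + u \<in> P"
  using mem_plane_iff_direction[OF assms(1,2), of "c + u"] assms(3) by simp

lemma subspace_direction:
  assumes "affine P" "P \<noteq> {}"
  shows "subspace (direction P)"
  using assms affine_diffs_subspace_subtract by (metis direction_conv_image ex_in_conv)

lemma dim_direction:
  assumes "affine P" "P \<noteq> {}"
  shows "int (dim (direction P)) = aff_dim P"
proof -
  obtain c where "c \<in> P" using assms(2) by blast
  then show ?thesis
    using aff_dim_dim_affine_diffs[of P c] direction_conv_image[of P c] assms(1) by simp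
qed

lemma normal_subspace_conv_direction:
  "normal_subspace P = {v. \<forall>u\<in>direction P. orthogonal u v}"
  by (auto simp: normal_subspace_def direction_def orthogonal_commute)

lemma subspace_normal_subspace: "subspace (normal_subspace P)"
  unfolding normal_subspace_conv_direction using subspace_orthogonal_to_vectors by blast

lemma dim_normal_subspace:
  fixes P :: "'a::euclidean_space set"
  assumes "affine P" "P \<noteq> {}"
  shows "dim (normal_subspace P) + dim (direction P) = DIM('a)"
  using dim_subspace_orthogonal_to_vectors[OF subspace_direction[OF assms] subspace_UNIV]
  by (simp add: normal_subspace_conv_direction)

lemma direction_iff_closest_point_normal:
  assumes "affine P" "P \<noteq> {}"
  shows "u \<in> direction P \<longleftrightarrow> closest_point (normal_subspace P) u = 0"
proof
  assume "u \<in> direction P"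
  then show "closest_point (normal_subspace P) u = 0"
    by (intro closest_point_subspace_eqI[OF subspace_normal_subspace])
      (auto simp: normal_subspace_conv_direction orthogonal_def inner_commute)
next
  assume u: "closest_point (normal_subspace P) u = 0"
  have sp: "span (direction P) = direction P"
    using subspace_direction[OF assms] by (simp add: span_eq_iff)
  obtain y z where yz: "y \<in> direction P" "\<And>w. w \<in> direction P \<Longrightarrow> orthogonal z w" "u = y + z"
    using orthogonal_subspace_decomp_exists[of "direction P" u] sp by metis
  have "z \<in> normal_subspace P"
    using yz(2) by (auto simp: normal_subspace_conv_direction orthogonal_commute)
  then have "u \<bullet> z = 0"
    using closest_point_subspace_orthogonal[OF subspace_normal_subspace, of z P u] u by simp
  moreover have "y \<bullet> z = 0" using yz(1,2) by (auto simp: orthogonal_def inner_commute)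
  ultimately have "z = 0" using yz(3) by (simp add: inner_add_left)
  then show "u \<in> direction P" using yz by simp
qed

lemma mem_plane_iff_closest_point_normal:
  assumes "affine P" "c \<in> P"
  shows "x \<in> P \<longleftrightarrow> closest_point (normal_subspace P) (x - c) = 0"
  using assms by (metis empty_iff mem_plane_iff_direction direction_iff_closest_point_normal)

text \<open>
  Each projection is linear, so expanding \<open>g q\<close> in the standard basis reduces a moving argument
  to finitely many fixed ones.
\<close>
lemma continuous_on_closest_point_subspaces:
  fixes N :: "'b::topological_space \<Rightarrow> 'a::euclidean_space set"
  assumes N: "\<And>q. q \<in> A \<Longrightarrow> subspace (N q)"
    and cont: "\<And>v. continuous_on A (\<lambda>q. closest_point (N q) v)"
    and g: "continuous_on A g"
  shows "continuous_on A (\<lambda>q. closest_point (N q) (g q))"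
proof -
  have eq: "closest_point (N q) (g q) = (\<Sum>b\<in>Basis. (g q \<bullet> b) *\<^sub>R closest_point (N q) b)" if "q \<in> A" for q
  proof -
    interpret linear "closest_point (N q)"
      by (rule linear_closest_point_subspace[OF N[OF that]])
    have "closest_point (N q) (\<Sum>b\<in>Basis. (g q \<bullet> b) *\<^sub>R b) = (\<Sum>b\<in>Basis. (g q \<bullet> b) *\<^sub>R closest_point (N q) b)"
      by (simp add: sum scaleR)
    then show ?thesis by (simp add: euclidean_representation)
  qed
  have "continuous_on A (\<lambda>q. \<Sum>b\<in>Basis. (g q \<bullet> b) *\<^sub>R closest_point (N q) b)"
    by (intro continuous_on_sum continuous_on_scaleR continuous_on_inner continuous_on_const g cont)
  then show ?thesis
    by (rule continuous_on_eq) (rule eq[symmetric])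
qed

section \<open>Unit spheres\<close>

lemma unit_direction_exists:
  assumes "is_unit_sphere n P c S"
  obtains u where "u \<in> direction P" "norm u = 1"
proof -
  have P: "affine P" "P \<noteq> {}" using assms by (auto simp: is_unit_sphere_def)
  have "dim (direction P) \<noteq> 0"
    using dim_direction[OF P] assms unfolding is_unit_sphere_def by linarith
  then obtain v where v: "v \<in> direction P" "v \<noteq> 0"
    unfolding dim_eq_0 by blast
  then have "(1 / norm v) *\<^sub>R v \<in> direction P"
    using subspace_direction[OF P] by (simp add: subspace_scale)
  then show ?thesis using v by (intro that[of "(1 / norm v) *\<^sub>R v"]) auto
qed

lemma sphere_mem_iff:
  assumes "is_unit_sphere n P c S"
  shows "x \<in> S \<longleftrightarrow> x - c \<in> direction P \<and> norm (x - c) = 1"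
  using assms mem_plane_iff_direction[of P c x] by (auto simp: is_unit_sphere_def)

lemma sphere_eq_rel_frontier:
  assumes "is_unit_sphere n P c S"
  shows "S = rel_frontier (cball c 1 \<inter> P)" and "affine hull (cball c 1 \<inter> P) = P"
    and "rel_interior (cball c 1 \<inter> P) = ball c 1 \<inter> P"
proof -
  have P: "affine P" "c \<in> P" and S: "S = {x \<in> P. norm (x - c) = 1}"
    using assms by (auto simp: is_unit_sphere_def)
  have ne: "interior (cball c 1) \<inter> P \<noteq> {}"
    using P(2) by (auto simp: disjoint_iff intro!: exI[of _ c])
  show "S = rel_frontier (cball c 1 \<inter> P)"
    unfolding convex_affine_rel_frontier_Int[OF convex_cball P(1) ne] frontier_cball S
    by (auto simp: dist_norm norm_minus_commute[of c])
  show "affine hull (cball c 1 \<inter> P) = P"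
    using affine_hull_convex_Int_nonempty_interior[of P "cball c 1"] ne P(1)
    by (simp add: Int_commute affine_imp_convex affine_hull_eq)
  show "rel_interior (cball c 1 \<inter> P) = ball c 1 \<inter> P"
    using rel_interior_convex_Int_affine[OF convex_cball P(1) ne] by simp
qed

text \<open>
  The plane is spanned by the sphere, and comparing the distances from \<open>c'\<close> to two antipodal points of the
  sphere gives \<open>|c - c'| = 0\<close>.  It follows that plane and centre are constant along a fibre.
\<close>
lemma unit_sphere_unique:
  assumes S: "is_unit_sphere n P c S" and S': "is_unit_sphere n P' c' S"
  shows "P = P' \<and> c = c'"
proof -
  have hull: "\<exists>u. u \<in> direction P \<and> c + u \<in> S \<and> c - u \<in> S" if S: "is_unit_sphere n P c S" for P c
  proof -
    obtain u where u: "u \<in> direction P" "norm u = 1" using unit_direction_exists[OF S] by blast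
    then have "- u \<in> direction P"
      using subspace_neg[OF subspace_direction] S by (auto simp: is_unit_sphere_def)
    then show ?thesis using u sphere_mem_iff[OF S] by (intro exI[of _ u]) auto
  qed
  have sub: "P \<subseteq> P'" if S: "is_unit_sphere n P c S" and S': "is_unit_sphere n P' c' S" for P c P' c'
  proof
    fix x assume x: "x \<in> P"
    have aff: "affine P" "c \<in> P" and aff': "affine P'" "S \<subseteq> P'"
      using S S' by (auto simp: is_unit_sphere_def)
    have c: "c \<in> P'"
    proof -
      obtain u where "c + u \<in> S" "c - u \<in> S" using hull[OF S] by blast
      then have "c + u \<in> P'" "c - u \<in> P'" using aff'(2) by blast+
      then have "(1/2) *\<^sub>R (c + u) + (1/2) *\<^sub>R (c - u) \<in> P'"
        by (rule mem_affine[OF aff'(1)]) simp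
      moreover have "(1/2) *\<^sub>R (c + u) + (1/2) *\<^sub>R (c - u) = c"
        by (simp add: algebra_simps flip: scaleR_add_left)
      ultimately show ?thesis by simp
    qed
    show "x \<in> P'"
    proof (cases "x = c")
      case False
      define t where "t = norm (x - c)"
      have t: "t > 0" using False by (simp add: t_def)
      have "c + (1 / t) *\<^sub>R (x - c) \<in> S"
        unfolding sphere_mem_iff[OF S]
        using x mem_plane_iff_direction[OF aff, of x] subspace_direction[OF aff(1)] aff(2) t
        by (auto simp: t_def intro!: subspace_scale)
      then have "c + t *\<^sub>R (c + (1 / t) *\<^sub>R (x - c) - c) \<in> P'"
        using mem_affine_3_minus[OF aff'(1) c _ c, of "c + (1 / t) *\<^sub>R (x - c)" t] aff' by blast
      then show ?thesis using t by simp
    qed (use c in simp)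
  qed
  have PP: "P = P'" using sub[OF S S'] sub[OF S' S] by blast
  obtain u where u: "c + u \<in> S" "c - u \<in> S" using hull[OF S] by blast
  have "norm (c + u - c) = 1" "norm (c + u - c') = 1" "norm (c - u - c') = 1"
    using u sphere_mem_iff[OF S] sphere_mem_iff[OF S'] by blast+
  then have "(norm (c + u - c))\<^sup>2 = 1" "(norm (c + u - c'))\<^sup>2 = 1" "(norm (c - u - c'))\<^sup>2 = 1"
    by simp_all
  then have "(c - c') \<bullet> (c - c') = 0"
    by (simp add: power2_norm_eq_inner algebra_simps inner_commute)
  then show ?thesis using PP by simp
qed

section \<open>Crossing points\<close>

definition crossing_point :: "'a::euclidean_space set \<Rightarrow> 'a \<Rightarrow> 'a set \<Rightarrow> 'a \<Rightarrow> 'a \<Rightarrow> bool" where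
  "crossing_point P c P' c' x \<longleftrightarrow> x \<in> P \<and> x \<in> P' \<and> norm (x - c) = norm (x - c') \<and> norm (x - c) < 1"

text \<open>
  Affine in \<open>x\<close>, since the quadratic terms of the first component cancel.
\<close>
definition crossing_map :: "'a::euclidean_space set \<Rightarrow> 'a \<Rightarrow> 'a \<Rightarrow> 'a \<Rightarrow> real \<times> 'a" where
  "crossing_map P' c' c x =
     ((norm (x - c'))\<^sup>2 - (norm (x - c))\<^sup>2, closest_point (normal_subspace P') (x - c'))"

text \<open>
  The linear part of \<^const>\<open>crossing_map\<close>.
\<close>
definition crossing_linear :: "'a::euclidean_space set \<Rightarrow> 'a \<Rightarrow> 'a \<Rightarrow> 'a \<Rightarrow> real \<times> 'a" where
  "crossing_linear P' c' c u = (2 * (u \<bullet> (c - c')), closest_point (normal_subspace P') u)"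

lemma crossing_map_eq_0_iff:
  assumes "affine P'" "c' \<in> P'"
  shows "crossing_map P' c' c x = 0 \<longleftrightarrow> x \<in> P' \<and> norm (x - c) = norm (x - c')"
  using mem_plane_iff_closest_point_normal[OF assms, of x]
  by (auto simp: crossing_map_def zero_prod_def power2_eq_iff_nonneg)

lemma crossing_point_iff_crossing_map:
  assumes "affine P'" "c' \<in> P'"
  shows "crossing_point P c P' c' x \<longleftrightarrow> x \<in> P \<and> norm (x - c) < 1 \<and> crossing_map P' c' c x = 0"
  by (auto simp: crossing_map_eq_0_iff[OF assms] crossing_point_def)

lemma linear_crossing_linear: "linear (crossing_linear P' c' c)"
proof -
  interpret linear "closest_point (normal_subspace P')"
    by (rule linear_closest_point_subspace[OF subspace_normal_subspace])
  show ?thesis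
    by (rule linearI) (simp_all add: crossing_linear_def add scale inner_add_left algebra_simps)
qed

lemma crossing_map_diff:
  "crossing_map P' c' c x - crossing_map P' c' c y = crossing_linear P' c' c (x - y)"
proof -
  interpret linear "closest_point (normal_subspace P')"
    by (rule linear_closest_point_subspace[OF subspace_normal_subspace])
  have "(norm (x - c'))\<^sup>2 - (norm (x - c))\<^sup>2 - ((norm (y - c'))\<^sup>2 - (norm (y - c))\<^sup>2)
      = 2 * ((x - y) \<bullet> (c - c'))"
    by (simp add: power2_norm_eq_inner algebra_simps inner_commute)
  moreover have "closest_point (normal_subspace P') (x - c') - closest_point (normal_subspace P') (y - c')
      = closest_point (normal_subspace P') (x - y)"
    by (simp flip: diff)
  ultimately show ?thesis
    by (simp add: crossing_map_def crossing_linear_def)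
qed

lemma crossing_linear_mem: "crossing_linear P' c' c u \<in> UNIV \<times> normal_subspace P'"
  by (simp add: crossing_linear_def closest_point_subspace_mem subspace_normal_subspace)

lemma crossing_map_mem: "crossing_map P' c' c x \<in> UNIV \<times> normal_subspace P'"
  by (simp add: crossing_map_def closest_point_subspace_mem subspace_normal_subspace)

lemma dim_direction_sphere:
  assumes "is_unit_sphere n P c S"
  shows "subspace (direction P)" and "dim (direction P) = n + 1"
proof -
  have P: "affine P" "P \<noteq> {}" "aff_dim P = int n + 1"
    using assms by (auto simp: is_unit_sphere_def)
  show "dim (direction P) = n + 1" using dim_direction[OF P(1,2)] P(3) by simp
  show "subspace (direction P)" by (rule subspace_direction[OF P(1,2)])
qed

text \<open>
  Moving from the crossing point along a vector of the kernel stays inside the zero set of the affine map, and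
  by the intermediate value theorem reaches the unit sphere \<open>S\<close>, at a point that also lies on \<open>T\<close>.
\<close>
lemma inj_on_crossing_linear:
  assumes S: "is_unit_sphere n P c S" and T: "is_unit_sphere n P' c' T" and dis: "S \<inter> T = {}"
    and x: "crossing_point P c P' c' x"
  shows "inj_on (crossing_linear P' c' c) (direction P)"
proof -
  have P: "affine P" "c \<in> P" and P': "affine P'" "c' \<in> P'"
    using S T by (auto simp: is_unit_sphere_def)
  interpret L: linear "crossing_linear P' c' c" by (rule linear_crossing_linear)
  have "u = 0" if u: "u \<in> direction P" "crossing_linear P' c' c u = 0" for u
  proof (rule ccontr)
    assume u0: "u \<noteq> 0"
    have xP: "x \<in> P" "norm (x - c) < 1" "crossing_map P' c' c x = 0"
      using x crossing_point_iff_crossing_map[OF P'] by auto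
    \<comment> \<open>At parameter \<open>2 / norm u\<close> the line has left the unit ball, whose diameter is 2.\<close>
    have "2 = norm ((2 / norm u) *\<^sub>R u)" using u0 by simp
    also have "\<dots> \<le> norm (x + (2 / norm u) *\<^sub>R u - c) + norm (x - c)"
      using norm_triangle_ineq4[of "x + (2 / norm u) *\<^sub>R u - c" "x - c"] by simp
    finally have far: "1 \<le> norm (x + (2 / norm u) *\<^sub>R u - c)" using xP(2) by linarith
    have "\<exists>t\<ge>0. t \<le> 2 / norm u \<and> norm (x + t *\<^sub>R u - c) = 1"
      by (rule IVT') (use far xP(2) in \<open>auto intro!: continuous_intros\<close>)
    then obtain t where t: "norm (x + t *\<^sub>R u - c) = 1" by blast
    define y where "y = x + t *\<^sub>R u"
    have yP: "y \<in> P"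
      unfolding y_def using u(1) subspace_direction[of P] P
      by (intro plane_add_direction[OF P(1) xP(1)]) (auto intro: subspace_scale)
    have "crossing_map P' c' c y = 0"
      using crossing_map_diff[of P' c' c y x] xP(3) u(2) by (simp add: y_def L.scale)
    then have "y \<in> P'" "norm (y - c') = 1"
      using t unfolding crossing_map_eq_0_iff[OF P'] y_def by auto
    then have "y \<in> S \<inter> T"
      using S T yP t by (simp add: is_unit_sphere_def y_def)
    then show False using dis by blast
  qed
  then show ?thesis
    using linear_injective_on_subspace_0[OF linear_crossing_linear dim_direction_sphere(1)[OF S]]
    by blast
qed

lemma dim_crossing_target:
  fixes P' :: "'a::euclidean_space set"
  assumes "is_unit_sphere n P' c' T"
  shows "subspace ((UNIV :: real set) \<times> normal_subspace P')"
    and "dim ((UNIV :: real set) \<times> normal_subspace P') + n = DIM('a)"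
proof -
  have P': "affine P'" "P' \<noteq> {}" "aff_dim P' = int n + 1"
    using assms by (auto simp: is_unit_sphere_def)
  have "dim (direction P') = n + 1" using dim_direction[OF P'(1,2)] P'(3) by simp
  then have "dim (normal_subspace P') + (n + 1) = DIM('a)"
    using dim_normal_subspace[OF P'(1,2)] by simp
  then show "dim ((UNIV :: real set) \<times> normal_subspace P') + n = DIM('a)"
    using dim_Times[OF subspace_UNIV subspace_normal_subspace, where ?'a=real and ?'b='a, of P']
    by simp
  show "subspace ((UNIV :: real set) \<times> normal_subspace P')"
    by (intro subspace_Times subspace_UNIV subspace_normal_subspace)
qed

lemma crossing_dim:
  fixes P :: "'a::euclidean_space set"
  assumes S: "is_unit_sphere n P c S" and T: "is_unit_sphere n P' c' T"
    and inj: "inj_on (crossing_linear P' c' c) (direction P)"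
  shows "DIM('a) \<ge> 2 * n + 1"
    and "DIM('a) = 2 * n + 1 \<Longrightarrow>
           crossing_linear P' c' c ` direction P = UNIV \<times> normal_subspace P'"
proof -
  note V = dim_direction_sphere[OF S] and W = dim_crossing_target[OF T]
  let ?W = "(UNIV :: real set) \<times> normal_subspace P'"
  have d: "dim (crossing_linear P' c' c ` direction P) = n + 1"
    using dim_image_eq[OF linear_crossing_linear, of P' c' c "direction P"] inj V
    by (simp add: span_eq_iff[THEN iffD2])
  have sub: "crossing_linear P' c' c ` direction P \<subseteq> ?W"
    using crossing_linear_mem by blast
  show "DIM('a) \<ge> 2 * n + 1"
    using dim_subset[OF sub] d W(2) by linarith
  show "crossing_linear P' c' c ` direction P = ?W" if "DIM('a) = 2 * n + 1"
  proof (rule subspace_dim_equal)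
    show "subspace (crossing_linear P' c' c ` direction P)"
      by (rule linear_subspace_image[OF linear_crossing_linear V(1)])
  qed (use W sub d that in auto)
qed

section \<open>Crossing spheres of middle dimension are linked\<close>

text \<open>
  A contractible sphere would be an absolute retract, hence a retract of its disc; composing
  such a retraction with the antipodal map contradicts Brouwer's fixed point theorem.
\<close>
lemma not_contractible_unit_sphere:
  assumes S: "is_unit_sphere n P c S"
  shows "\<not> contractible S"
proof
  assume contr: "contractible S"
  have P: "affine P" "c \<in> P" using S by (auto simp: is_unit_sphere_def)
  define D where "D = cball c 1 \<inter> P"
  have D: "compact D" "convex D" "c \<in> D"
    using P by (auto simp: D_def compact_Int_closed affine_closed convex_Int affine_imp_convex)
  have SD: "S = rel_frontier D" using sphere_eq_rel_frontier[OF S] by (simp add: D_def)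
  obtain u where u: "u \<in> direction P" "norm u = 1" using unit_direction_exists[OF S] by blast
  then have "c + u \<in> S" by (simp add: sphere_mem_iff[OF S])
  then have "AR S"
    using contr ANR_rel_frontier_convex[of D] D by (auto simp: AR_ANR SD compact_imp_bounded)
  moreover have "S \<subseteq> D" using S by (auto simp: is_unit_sphere_def D_def dist_norm norm_minus_commute[of c])
  moreover have "closed S"
    using D(1) by (simp add: SD closed_rel_frontier)
  ultimately have "S retract_of D"
    using AR_imp_retract by (meson closed_subset)
  then obtain r where r: "continuous_on D r" "r \<in> D \<rightarrow> S" "\<And>x. x \<in> S \<Longrightarrow> r x = x"
    by (auto simp: retract_of_def retraction_def)
  have neg: "2 *\<^sub>R c - y \<in> S" if "y \<in> S" for y
  proof -
    have "- (y - c) \<in> direction P"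
      using that sphere_mem_iff[OF S] subspace_neg[OF dim_direction_sphere(1)[OF S]] by blast
    moreover have "2 *\<^sub>R c - y - c = - (y - c)" by (simp add: scaleR_2)
    moreover have "norm (- (y - c)) = 1"
      using that sphere_mem_iff[OF S] by (simp only: norm_minus_cancel)
    ultimately show ?thesis unfolding sphere_mem_iff[OF S] by metis
  qed
  obtain x where x: "x \<in> D" "2 *\<^sub>R c - r x = x"
  proof (rule brouwer[OF D(1,2)])
    show "D \<noteq> {}" using D(3) by blast
    show "continuous_on D (\<lambda>x. 2 *\<^sub>R c - r x)" by (intro continuous_intros r)
    show "(\<lambda>x. 2 *\<^sub>R c - r x) \<in> D \<rightarrow> D" using r(2) neg \<open>S \<subseteq> D\<close> by blast
  qed
  then have "x \<in> S" using neg r(2) by (metis PiE)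
  with r(3) x have "2 *\<^sub>R (x - c) = 0" by (simp add: algebra_simps scaleR_2)
  then show False using \<open>x \<in> S\<close> sphere_mem_iff[OF S] by simp
qed

text \<open>
  Coordinates with respect to an orthonormal basis of the direction of the plane.
\<close>
lemma nsphere_homeomorphic_unit_sphere:
  fixes P :: "'a::euclidean_space set"
  assumes S: "is_unit_sphere n P c S"
  shows "nsphere n homeomorphic_space top_of_set S"
proof -
  note V = dim_direction_sphere[OF S]
  obtain B where B: "B \<subseteq> direction P" "pairwise orthogonal B" "\<And>x. x \<in> B \<Longrightarrow> norm x = 1"
      "independent B" "card B = n + 1" "span B = direction P"
    using orthonormal_basis_subspace[OF V(1)] V(2) by metis
  have fin: "finite B" using B(4) independent_imp_finite by blast
  obtain e where e: "bij_betw e {0..<n + 1} B" using ex_bij_betw_nat_finite[OF fin] B(5) by auto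
  have idx: "{0..<n + 1} = {..n}" by auto
  have eB: "e i \<in> B" if "i \<le> n" for i using e that by (auto simp: bij_betw_def idx)
  have ortho: "e i \<bullet> e j = (if i = j then 1 else 0)" if "i \<le> n" "j \<le> n" for i j
  proof (cases "i = j")
    case True
    then show ?thesis using B(3)[OF eB[OF that(1)]] by (simp add: dot_square_norm)
  next
    case False
    then have "e i \<noteq> e j" using e that by (auto simp: bij_betw_def idx inj_on_def)
    then show ?thesis using B(2) eB that False by (auto simp: pairwise_def orthogonal_def)
  qed
  define Z where "Z = {x :: nat \<Rightarrow> real. (\<Sum>i\<le>n. (x i)\<^sup>2) = 1 \<and> (\<forall>i>n. x i = 0)}"
  have ns: "nsphere n = top_of_set Z"
    by (simp add: nsphere Z_def euclidean_product_topology)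
  define v where "v x = (\<Sum>i\<le>n. x i *\<^sub>R e i)" for x :: "nat \<Rightarrow> real"
  define f where "f x = c + v x" for x
  define g where "g y = (\<lambda>i. if i \<le> n then (y - c) \<bullet> e i else 0)" for y
  have vi: "v x \<bullet> e j = x j" if "j \<le> n" for x j
  proof -
    have "v x \<bullet> e j = (\<Sum>i\<le>n. x i * (if i = j then 1 else 0))"
      unfolding v_def inner_sum_left by (intro sum.cong refl) (use that in \<open>simp add: ortho\<close>)
    then show ?thesis using that by (simp add: if_distrib cong: if_cong)
  qed
  have vn: "(norm (v x))\<^sup>2 = (\<Sum>i\<le>n. (x i)\<^sup>2)" for x
  proof -
    have "v x \<bullet> v x = (\<Sum>i\<le>n. x i * (v x \<bullet> e i))"
      by (subst (2) v_def) (simp add: inner_sum_right)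
    also have "\<dots> = (\<Sum>i\<le>n. (x i)\<^sup>2)"
      by (intro sum.cong refl) (simp add: vi power2_eq_square)
    finally show ?thesis by (simp add: power2_norm_eq_inner)
  qed
  have vV: "v x \<in> direction P" for x
    unfolding v_def using B(1) eB by (intro subspace_sum[OF V(1)] subspace_scale[OF V(1)]) auto
  have vg: "v (g y) = y - c" if y: "y \<in> S" for y
  proof -
    define w where "w = y - c - v (g y)"
    have w: "w \<in> span B"
      using y sphere_mem_iff[OF S] vV subspace_diff[OF V(1)] by (auto simp: w_def B(6))
    have "w \<bullet> e j = 0" if "j \<le> n" for j
      using that by (simp add: w_def inner_diff_left vi) (simp add: g_def inner_diff_left)
    then have "orthogonal w b" if "b \<in> B" for b
      using that e by (auto simp: bij_betw_def idx orthogonal_def)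
    then have "orthogonal w w" using w orthogonal_to_span by blast
    then show ?thesis by (simp add: w_def orthogonal_def)
  qed
  have "homeomorphic_maps (nsphere n) (top_of_set S) f g"
    unfolding homeomorphic_maps_def ns
  proof (intro conjI ballI)
    have "continuous_on Z f"
      unfolding f_def v_def
      by (intro continuous_intros continuous_on_product_coordinates[THEN continuous_on_subset]) auto
    moreover have "f x \<in> S" if "x \<in> Z" for x
      using that vV vn[of x] unfolding sphere_mem_iff[OF S] f_def Z_def by (auto simp: abs_square_eq_1)
    ultimately show "continuous_map (top_of_set Z) (top_of_set S) f" by auto
    have "g y \<in> Z" if "y \<in> S" for y
    proof -
      have "(norm (v (g y)))\<^sup>2 = 1" using vg[OF that] that sphere_mem_iff[OF S] by simp
      then show ?thesis unfolding vn by (simp add: Z_def) (simp add: g_def)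
    qed
    moreover have "continuous_on S g"
    proof (rule continuous_on_coordinatewise_then_product)
      fix i show "continuous_on S (\<lambda>y. g y i)"
        by (cases "i \<le> n") (auto simp: g_def intro!: continuous_intros)
    qed
    ultimately show "continuous_map (top_of_set S) (top_of_set Z) g" by auto
  next
    fix x assume "x \<in> topspace (top_of_set Z)"
    then show "g (f x) = x" by (auto simp: g_def f_def vi Z_def)
  next
    fix y assume "y \<in> topspace (top_of_set S)"
    then show "f (g y) = y" by (simp add: f_def vg)
  qed
  then show ?thesis unfolding homeomorphic_space_def by blast
qed

text \<open>
  A null-homotopy of \<open>S\<close> in the complement of \<open>T\<close>, pushed into \<open>S\<close> by the retraction, would
  contract \<open>S\<close>.
\<close>
lemma linked_if_retract:
  assumes S: "is_unit_sphere n P c S" and T: "is_unit_sphere n P' c' T"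
    and ret: "S retract_of (- T)"
  shows "linked n S T"
  unfolding linked_def
proof (intro conjI allI impI)
  have "S \<subseteq> - T" using ret retract_of_imp_subset by blast
  then show "disjnt S T" by (auto simp: disjnt_def)
  show "nsphere n homeomorphic_space top_of_set S" "nsphere n homeomorphic_space top_of_set T"
    using nsphere_homeomorphic_unit_sphere S T by blast+
  fix f b
  assume fb: "homeomorphic_map (nsphere n) (top_of_set S) f \<and> b \<in> topspace (nsphere n)"
  then obtain g where g: "continuous_map (top_of_set S) (nsphere n) g" "\<And>y. y \<in> S \<Longrightarrow> f (g y) = y"
    unfolding homeomorphic_map_maps homeomorphic_maps_def by auto
  obtain r where r: "continuous_on (- T) r" "r \<in> (- T) \<rightarrow> S" "\<And>x. x \<in> S \<Longrightarrow> r x = x"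
    using ret by (auto simp: retract_of_def retraction_def)
  have rmap: "continuous_map (top_of_set (- T)) (top_of_set S) r" using r by auto
  show "\<not> homotopic_with (\<lambda>h. h b = f b) (nsphere n) (top_of_set (- T)) f (\<lambda>_. f b)"
  proof
    assume "homotopic_with (\<lambda>h. h b = f b) (nsphere n) (top_of_set (- T)) f (\<lambda>_. f b)"
    then have "homotopic_with (\<lambda>h. True) (nsphere n) (top_of_set (- T)) f (\<lambda>_. f b)"
      by (rule homotopic_with_mono) simp
    then have "homotopic_with (\<lambda>h. True) (top_of_set S) (top_of_set (- T)) (f \<circ> g) ((\<lambda>_. f b) \<circ> g)"
      by (rule homotopic_with_compose_continuous_map_right[OF _ g(1)]) simp
    then have "homotopic_with (\<lambda>h. True) (top_of_set S) (top_of_set S)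
        (r \<circ> (f \<circ> g)) (r \<circ> ((\<lambda>_. f b) \<circ> g))"
      by (rule homotopic_with_compose_continuous_map_left[OF _ rmap]) simp
    then have "homotopic_with (\<lambda>h. True) (top_of_set S) (top_of_set S) id (\<lambda>_. r (f b))"
      by (rule homotopic_with_eq) (use g r in auto)
    then have "contractible S" unfolding contractible_def by blast
    then show False using not_contractible_unit_sphere[OF S] by blast
  qed
qed

text \<open>
  The map \<open>\<psi>\<close> below is defined on the whole space and vanishes exactly on \<open>T\<close>.  On \<open>S\<close> it agrees with
  the affine isomorphism \<^const>\<open>crossing_map\<close>, whose inverse therefore turns it into a map that fixes \<open>S\<close> and takes
  the complement of \<open>T\<close> to the plane of \<open>S\<close> without the crossing point.
\<close>
lemma crossing_imp_retract:
  fixes P :: "'a::euclidean_space set"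
  assumes S: "is_unit_sphere n P c S" and T: "is_unit_sphere n P' c' T" and dis: "S \<inter> T = {}"
    and x: "crossing_point P c P' c' x" and dim: "DIM('a) = 2 * n + 1"
  shows "S retract_of (- T)"
proof -
  have P: "affine P" "c \<in> P" and P': "affine P'" "c' \<in> P'"
    using S T by (auto simp: is_unit_sphere_def)
  let ?L = "crossing_linear P' c' c"
  have inj: "inj_on ?L (direction P)"
    by (rule inj_on_crossing_linear[OF S T dis x])
  have im: "?L ` direction P = UNIV \<times> normal_subspace P'"
    by (rule crossing_dim(2)[OF S T inj dim])
  obtain g where g: "linear g" "\<And>v. v \<in> direction P \<Longrightarrow> g (?L v) = v"
    using linear_exists_left_inverse_on[OF linear_crossing_linear subspace_direction[OF P(1)] inj] P(2)
    by auto
  have xP: "x \<in> P" "norm (x - c) < 1" "crossing_map P' c' c x = 0"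
    using x crossing_point_iff_crossing_map[OF P'] by auto
  define \<psi> where "\<psi> y = ((norm (y - c'))\<^sup>2 - 1, closest_point (normal_subspace P') (y - c'))" for y
  have \<psi>S: "x + g (\<psi> y) = y" if y: "y \<in> S" for y
  proof -
    have "\<psi> y = crossing_map P' c' c y - crossing_map P' c' c x"
      using y xP(3) by (simp add: \<psi>_def crossing_map_def sphere_mem_iff[OF S])
    then have "\<psi> y = ?L (y - x)" by (simp add: crossing_map_diff)
    moreover have "y - x \<in> direction P"
      using y S xP(1) mem_plane_iff_direction[OF P(1) xP(1)] by (auto simp: is_unit_sphere_def)
    ultimately show ?thesis using g(2) by simp
  qed
  have \<psi>T: "x + g (\<psi> y) \<in> P - {x}" if y: "y \<notin> T" for y
  proof -
    have "\<psi> y \<in> UNIV \<times> normal_subspace P'"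
      by (simp add: \<psi>_def closest_point_subspace_mem subspace_normal_subspace)
    then have "\<psi> y \<in> ?L ` direction P" by (simp only: im)
    then obtain v where v: "v \<in> direction P" "\<psi> y = ?L v" by (rule imageE)
    have "\<psi> y \<noteq> 0"
    proof
      assume "\<psi> y = 0"
      then have "(norm (y - c'))\<^sup>2 = 1" "y \<in> P'"
        using mem_plane_iff_closest_point_normal[OF P', of y] by (auto simp: \<psi>_def zero_prod_def)
      then show False using y T by (auto simp: is_unit_sphere_def abs_square_eq_1)
    qed
    then have "v \<noteq> 0" using v(2) linear_0[OF linear_crossing_linear] by metis
    then show ?thesis
      using v g(2) plane_add_direction[OF P(1) xP(1) v(1)] by simp
  qed
  define D where "D = cball c 1 \<inter> P"
  have "rel_frontier D retract_of (affine hull D - {x})"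
  proof (rule rel_frontier_retract_of_punctured_affine_hull)
    show "bounded D" "convex D"
      using P by (auto simp: D_def bounded_Int affine_imp_convex convex_Int)
    show "x \<in> rel_interior D"
      using sphere_eq_rel_frontier(3)[OF S] xP by (simp add: D_def dist_norm norm_minus_commute[of c])
  qed
  then have "S retract_of (P - {x})"
    using sphere_eq_rel_frontier(1,2)[OF S] by (simp add: D_def)
  then obtain r where r: "continuous_on (P - {x}) r" "r \<in> (P - {x}) \<rightarrow> S" "\<And>y. y \<in> S \<Longrightarrow> r y = y"
    by (auto simp: retract_of_def retraction_def)
  have "continuous_on (- T) (\<lambda>y. y - c')" by (intro continuous_intros)
  then have "continuous_on (- T) (\<lambda>y. closest_point (normal_subspace P') (y - c'))"
    by (rule linear_continuous_on_compose[OF _ linear_closest_point_subspace[OF subspace_normal_subspace]])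
  then have "continuous_on (- T) \<psi>"
    unfolding \<psi>_def by (intro continuous_on_Pair) (intro continuous_intros)
  then have "continuous_on (- T) (\<lambda>y. g (\<psi> y))"
    by (rule linear_continuous_on_compose[OF _ g(1)])
  then have "continuous_on (- T) (\<lambda>y. x + g (\<psi> y))"
    by (intro continuous_on_add continuous_on_const)
  then have "continuous_on (- T) (\<lambda>y. r (x + g (\<psi> y)))"
    by (rule continuous_on_compose2[OF r(1)]) (use \<psi>T in auto)
  then have "retraction (- T) S (\<lambda>y. r (x + g (\<psi> y)))"
    unfolding retraction_def using dis \<psi>T r \<psi>S by auto
  then show ?thesis by (auto simp: retract_of_def)
qed

section \<open>Operator distance and zeros of vector fields on a disc\<close>

lemma norm_linear_diff_le:
  fixes f g :: "'a::euclidean_space \<Rightarrow> 'b::real_normed_vector"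
  assumes "linear f" "linear g"
  shows "norm (f u - g u) \<le> norm u * (\<Sum>b\<in>Basis. norm (f b - g b))"
proof -
  interpret f: linear f by fact
  interpret g: linear g by fact
  have "f u - g u = f (\<Sum>b\<in>Basis. (u \<bullet> b) *\<^sub>R b) - g (\<Sum>b\<in>Basis. (u \<bullet> b) *\<^sub>R b)"
    by (simp only: euclidean_representation)
  also have "\<dots> = (\<Sum>b\<in>Basis. (u \<bullet> b) *\<^sub>R (f b - g b))"
    by (simp add: f.sum g.sum f.scale g.scale sum_subtractf scaleR_diff_right)
  finally have "norm (f u - g u) \<le> (\<Sum>b\<in>Basis. norm ((u \<bullet> b) *\<^sub>R (f b - g b)))"
    by (simp only: norm_sum)
  also have "\<dots> \<le> (\<Sum>b\<in>Basis. norm u * norm (f b - g b))"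
    by (intro sum_mono) (simp add: Basis_le_norm mult_right_mono)
  finally show ?thesis by (simp add: sum_distrib_left)
qed

text \<open>
  If \<open>f\<close> had no zero, then rescaling \<open>- f\<close> to length \<open>\<epsilon>\<close> would give a self-map of the disc
  without fixed point: a fixed point \<open>w\<close> would lie on the boundary and satisfy \<open>f w \<bullet> w < 0\<close>.
\<close>
lemma poincare_bohl_subspace:
  fixes f :: "'a::euclidean_space \<Rightarrow> 'a"
  assumes N: "subspace N" and \<epsilon>: "\<epsilon> > 0"
    and cont: "continuous_on (cball 0 \<epsilon> \<inter> N) f" and fN: "\<And>w. w \<in> cball 0 \<epsilon> \<inter> N \<Longrightarrow> f w \<in> N"
    and out: "\<And>w. w \<in> N \<Longrightarrow> norm w = \<epsilon> \<Longrightarrow> f w \<bullet> w > 0"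
  obtains w where "w \<in> N" "norm w \<le> \<epsilon>" "f w = 0"
proof -
  have "\<exists>w\<in>cball 0 \<epsilon> \<inter> N. f w = 0"
  proof (rule ccontr)
    assume "\<not> ?thesis"
    then have nz: "f w \<noteq> 0" if "w \<in> cball 0 \<epsilon> \<inter> N" for w using that by blast
    define g where "g w = (- \<epsilon> / norm (f w)) *\<^sub>R f w" for w
    obtain w where w: "w \<in> cball 0 \<epsilon> \<inter> N" "g w = w"
    proof (rule brouwer[of "cball 0 \<epsilon> \<inter> N" g])
      show "compact (cball 0 \<epsilon> \<inter> N)" by (simp add: compact_Int_closed closed_subspace N)
      show "convex (cball 0 \<epsilon> \<inter> N)" by (simp add: convex_Int subspace_imp_convex N)
      show "cball 0 \<epsilon> \<inter> N \<noteq> {}" using \<epsilon> subspace_0[OF N] by (auto simp: disjoint_iff intro!: exI[of _ 0])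
      show "continuous_on (cball 0 \<epsilon> \<inter> N) g"
        unfolding g_def using nz by (intro continuous_intros cont) auto
      have "g w \<in> N" if "w \<in> cball 0 \<epsilon> \<inter> N" for w
        unfolding g_def by (rule subspace_scale[OF N fN[OF that]])
      moreover have "norm (g w) = \<epsilon>" if "w \<in> cball 0 \<epsilon> \<inter> N" for w
        using nz[OF that] \<epsilon> by (simp add: g_def)
      ultimately show "g \<in> cball 0 \<epsilon> \<inter> N \<rightarrow> cball 0 \<epsilon> \<inter> N" by auto
    qed
    have "norm w = norm (g w)" using w(2) by simp
    also have "\<dots> = \<epsilon>" using nz[OF w(1)] \<epsilon> by (simp add: g_def)
    finally have nw: "norm w = \<epsilon>" .
    have "f w \<bullet> w = f w \<bullet> g w" using w(2) by simp
    also have "\<dots> = - \<epsilon> * norm (f w)"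
      using nz[OF w(1)] by (simp add: g_def dot_square_norm power2_eq_square)
    also have "\<dots> < 0" using nz[OF w(1)] \<epsilon> by (simp add: mult_neg_pos)
    finally show False using out[of w] nw w(1) by simp
  qed
  then show ?thesis using that by auto
qed


section \<open>The crossing relation between fibres\<close>

text \<open>
  The choice of plane and centre is a parameter here, so that both can be treated as continuous
  functions on \<open>E\<close>.
\<close>
locale parametrized_sphere_fibration =
  fixes n :: nat and E :: "'a::euclidean_space set" and F :: "'a set set"
    and P :: "'a \<Rightarrow> 'a set" and c :: "'a \<Rightarrow> 'a"
  assumes open_E: "open E" and Union_F: "\<Union>F = E" and disjoint_F: "disjoint F"
    and nonempty_F: "{} \<notin> F"
    and sphere: "\<And>S p. S \<in> F \<Longrightarrow> p \<in> S \<Longrightarrow> is_unit_sphere n (P p) (c p) S"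
    and continuous_centre: "continuous_on E c"
    and continuous_normal: "\<And>v. continuous_on E (\<lambda>p. closest_point (normal_subspace (P p)) v)"
begin

abbreviation normal_part :: "'a \<Rightarrow> 'a \<Rightarrow> 'a" where
  "normal_part p \<equiv> closest_point (normal_subspace (P p))"

definition fibre :: "'a \<Rightarrow> 'a set" where
  "fibre p = {x \<in> P p. norm (x - c p) = 1}"

definition crosses :: "'a \<Rightarrow> 'a \<Rightarrow> bool" where
  "crosses p q \<longleftrightarrow> (\<exists>x. crossing_point (P p) (c p) (P q) (c q) x)"

lemma fibre_eq: "S \<in> F \<Longrightarrow> p \<in> S \<Longrightarrow> S = fibre p"
  using sphere[of S p] by (simp add: is_unit_sphere_def fibre_def)

lemma fibre_props:
  assumes "p \<in> E"
  shows fibre_mem_F: "fibre p \<in> F" and self_mem_fibre: "p \<in> fibre p"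
    and is_unit_sphere_fibre: "is_unit_sphere n (P p) (c p) (fibre p)"
proof -
  obtain S where S: "S \<in> F" "p \<in> S" using assms Union_F by blast
  then have "S = fibre p" by (rule fibre_eq)
  with S sphere[OF S] show "fibre p \<in> F" "p \<in> fibre p" "is_unit_sphere n (P p) (c p) (fibre p)"
    by simp_all
qed

lemma plane_props:
  assumes "p \<in> E"
  shows affine_P: "affine (P p)" and centre_mem_P: "c p \<in> P p"
    and mem_own_plane: "p \<in> P p" and norm_own_centre: "norm (p - c p) = 1"
  using is_unit_sphere_fibre[OF assms] self_mem_fibre[OF assms] by (auto simp: is_unit_sphere_def)

lemma fibre_subset: "p \<in> E \<Longrightarrow> fibre p \<subseteq> E"
  using fibre_mem_F Union_F by blast

lemma fibre_mem_eq:
  assumes "p \<in> E" "q \<in> fibre p"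
  shows "fibre q = fibre p" "P q = P p" "c q = c p"
proof -
  have q: "q \<in> E" using fibre_subset assms by blast
  show eq: "fibre q = fibre p" using fibre_eq[OF fibre_mem_F[OF assms(1)] assms(2)] by simp
  show "P q = P p" "c q = c p"
    using unit_sphere_unique[OF is_unit_sphere_fibre[OF q], unfolded eq, OF is_unit_sphere_fibre[OF assms(1)]]
    by simp_all
qed

lemma fibres_meet_imp:
  assumes "p \<in> E" "q \<in> E" "x \<in> fibre p" "x \<in> fibre q"
  shows "q \<in> fibre p"
  using fibre_mem_eq(1)[OF assms(1,3)] fibre_mem_eq(1)[OF assms(2,4)] self_mem_fibre[OF assms(2)] by simp

lemma crosses_own_fibre:
  assumes "p \<in> E" "q \<in> fibre p"
  shows "crosses p q"
  unfolding crosses_def crossing_point_def fibre_mem_eq(2,3)[OF assms]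
  using centre_mem_P[OF assms(1)] by (intro exI[of _ "c p"]) simp

lemma continuous_normal_part:
  assumes "A \<subseteq> E" "continuous_on A g"
  shows "continuous_on A (\<lambda>q. normal_part q (g q))"
  by (rule continuous_on_closest_point_subspaces)
    (use assms subspace_normal_subspace continuous_on_subset[OF continuous_normal] in auto)

text \<open>
  Crossing points lie in a compact disc, so they have limit points.  A limit can fail to be a crossing point only by lying
  on the unit sphere; it then lies on both fibres, which therefore coincide, and the centre is a
  crossing point.
\<close>
lemma closedin_crosses:
  assumes p: "p \<in> E"
  shows "closedin (top_of_set E) {q \<in> E. crosses p q}"
proof -
  define K where "K = cball (c p) 1 \<inter> P p"
  have K: "compact K" unfolding K_def by (simp add: compact_Int_closed affine_closed affine_P[OF p])
  define G where "G = (\<lambda>(x, q). crossing_map (P q) (c q) (c p) x)"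
  have q1: "continuous_on (K \<times> E) (\<lambda>z. c (snd z))"
    by (rule continuous_on_compose2[OF continuous_centre]) (auto intro!: continuous_intros)
  have q2: "continuous_on (K \<times> E) (\<lambda>z. normal_part (snd z) v)" for v
    by (rule continuous_on_compose2[OF continuous_normal]) (auto intro!: continuous_intros)
  have "continuous_on (K \<times> E) (\<lambda>z. normal_part (snd z) (fst z - c (snd z)))"
    by (rule continuous_on_closest_point_subspaces[OF subspace_normal_subspace q2])
      (intro continuous_intros q1)
  then have contG: "continuous_on (K \<times> E) G"
    unfolding G_def crossing_map_def case_prod_unfold
    by (intro continuous_on_Pair) (intro continuous_intros q1)
  have "closedin (top_of_set (K \<times> E)) {z \<in> K \<times> E. G z = 0}"
    using continuous_closedin_preimage[OF contG, of "{0}"] by (simp add: vimage_def Int_def)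
  from closedin_compact_projection[OF K this]
  have "closedin (top_of_set E) {q. \<exists>x. x \<in> K \<and> (x, q) \<in> {z \<in> K \<times> E. G z = 0}}" .
  moreover have "crosses p q \<longleftrightarrow> (\<exists>x\<in>K. G (x, q) = 0)" if q: "q \<in> E" for q
  proof
    assume "crosses p q"
    then show "\<exists>x\<in>K. G (x, q) = 0"
      unfolding crosses_def crossing_point_iff_crossing_map[OF affine_P[OF q] centre_mem_P[OF q]]
      by (auto simp: K_def G_def dist_norm norm_minus_commute[of "c p"] intro!: bexI)
  next
    assume "\<exists>x\<in>K. G (x, q) = 0"
    then obtain x where x: "x \<in> P p" "norm (x - c p) \<le> 1" "crossing_map (P q) (c q) (c p) x = 0"
      by (auto simp: K_def G_def dist_norm norm_minus_commute[of "c p"])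
    show "crosses p q"
    proof (cases "norm (x - c p) = 1")
      case True
      then have "x \<in> fibre p" "x \<in> fibre q"
        using x crossing_map_eq_0_iff[OF affine_P[OF q] centre_mem_P[OF q]]
        by (auto simp: fibre_def)
      then show ?thesis using fibres_meet_imp[OF p q] crosses_own_fibre[OF p] by blast
    next
      case False
      then show ?thesis
        unfolding crosses_def crossing_point_iff_crossing_map[OF affine_P[OF q] centre_mem_P[OF q]]
        using x by (intro exI[of _ x]) simp
    qed
  qed
  then have "{q. \<exists>x. x \<in> K \<and> (x, q) \<in> {z \<in> K \<times> E. G z = 0}} = {q \<in> E. crosses p q}"
    by blast
  ultimately show ?thesis by simp
qed

text \<open>
  By \<open>inj_on_crossing_linear\<close> the linear part is bounded below by some \<open>m\<close>, and for \<open>q'\<close> near \<open>q\<close>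
  still by \<open>m / 2\<close>.  So it remains injective, and for reasons of dimension bijective; its affine map has
  a zero \<open>x + u\<close>, where \<open>|u|\<close> is at most \<open>2 / m\<close> times the small value of that map at \<open>x\<close>.
  On the fibre of \<open>p\<close> the linear part vanishes on the direction of the plane; that case is left to \<open>near_fibre_crosses\<close>.
\<close>
lemma crosses_stable:
  assumes dim: "DIM('a) = 2 * n + 1" and p: "p \<in> E" and q: "q \<in> E" "q \<notin> fibre p" and cr: "crosses p q"
  obtains e where "e > 0" "\<And>q'. q' \<in> E \<Longrightarrow> dist q' q < e \<Longrightarrow> crosses p q'"
proof -
  define L where "L q = crossing_linear (P q) (c q) (c p)" for q
  define G where "G q = crossing_map (P q) (c q) (c p)" for q
  have linL: "linear (L q)" for q unfolding L_def by (rule linear_crossing_linear)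
  note V = dim_direction_sphere[OF is_unit_sphere_fibre[OF p]]
  obtain x where x: "crossing_point (P p) (c p) (P q) (c q) x" using cr by (auto simp: crosses_def)
  then have xP: "x \<in> P p" "norm (x - c p) < 1" "G q x = 0"
    unfolding G_def crossing_point_iff_crossing_map[OF affine_P[OF q(1)] centre_mem_P[OF q(1)]] by auto
  have "fibre p \<inter> fibre q = {}" using fibres_meet_imp[OF p q(1)] q(2) by blast
  then have inj: "inj_on (L q) (direction (P p))"
    unfolding L_def by (rule inj_on_crossing_linear[OF is_unit_sphere_fibre[OF p] is_unit_sphere_fibre[OF q(1)] _ x])
  obtain m where m: "m > 0" "\<And>u. u \<in> direction (P p) \<Longrightarrow> m * norm u \<le> norm (L q u)"
  proof -
    have "\<forall>u\<in>direction (P p). L q u = 0 \<longrightarrow> u = 0"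
      using inj linear_injective_on_subspace_0[OF linL V(1)] by blast
    then show ?thesis
      using injective_imp_isometric[OF closed_subspace[OF V(1)] V(1), of "L q"] linL that
      by (auto simp: linear_conv_bounded_linear mult.commute)
  qed
  define \<omega> where "\<omega> q' = (\<Sum>b\<in>Basis. norm (L q' b - L q b))" for q'
  have "continuous_on E \<omega>"
    unfolding \<omega>_def L_def crossing_linear_def
    by (intro continuous_intros continuous_centre continuous_normal)
  then have "isCont \<omega> q" using open_E q(1) by (simp add: continuous_on_eq_continuous_at)
  then have \<omega>: "(\<omega> \<longlongrightarrow> 0) (at q)" by (simp add: isCont_def \<omega>_def)
  have "continuous_on E (\<lambda>q'. G q' x)"
    unfolding G_def crossing_map_def
    by (intro continuous_on_Pair continuous_normal_part) (auto intro!: continuous_intros continuous_centre)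
  then have "isCont (\<lambda>q'. G q' x) q" using open_E q(1) by (simp add: continuous_on_eq_continuous_at)
  then have G: "((\<lambda>q'. G q' x) \<longlongrightarrow> 0) (at q)" by (simp add: isCont_def xP)
  have "\<forall>\<^sub>F q' in at q. \<omega> q' < m / 2 \<and> norm (G q' x) < m / 2 * (1 - norm (x - c p))"
    using order_tendstoD(2)[OF \<omega>, of "m / 2"] m(1) xP(2)
      order_tendstoD(2)[OF tendsto_norm_zero[OF G], of "m / 2 * (1 - norm (x - c p))"]
    by (intro eventually_conj) auto
  then obtain e where e: "e > 0"
    "\<And>q'. q' \<noteq> q \<Longrightarrow> dist q' q < e \<Longrightarrow> \<omega> q' < m / 2 \<and> norm (G q' x) < m / 2 * (1 - norm (x - c p))"
    by (auto simp: eventually_at)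
  have "crosses p q'" if q': "q' \<in> E" "dist q' q < e" for q'
  proof (cases "q' = q")
    case False
    then have small: "\<omega> q' < m / 2" "norm (G q' x) < m / 2 * (1 - norm (x - c p))"
      using e(2) q' by blast+
    have low: "m / 2 * norm u \<le> norm (L q' u)" if "u \<in> direction (P p)" for u
    proof -
      have "norm (L q' u - L q u) \<le> norm u * \<omega> q'"
        unfolding \<omega>_def by (rule norm_linear_diff_le[OF linL linL])
      also have "\<dots> \<le> norm u * (m / 2)" using small(1) by (intro mult_left_mono) auto
      finally have "norm (L q u) - norm u * (m / 2) \<le> norm (L q' u)"
        using norm_triangle_ineq2[of "L q u" "L q' u"] by (simp add: norm_minus_commute)
      then show ?thesis using m(2)[OF that] by (simp add: field_simps)
    qed
    have "inj_on (L q') (direction (P p))"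
    proof (subst linear_injective_on_subspace_0[OF linL V(1)], intro ballI impI)
      fix u assume "u \<in> direction (P p)" "L q' u = 0"
      then have "m / 2 * norm u \<le> 0" using low by fastforce
      then show "u = 0" using m(1) by (simp add: mult_le_0_iff)
    qed
    then have "L q' ` direction (P p) = UNIV \<times> normal_subspace (P q')"
      unfolding L_def
      by (rule crossing_dim(2)[OF is_unit_sphere_fibre[OF p] is_unit_sphere_fibre[OF q'(1)] _ dim])
    moreover have "- G q' x \<in> UNIV \<times> normal_subspace (P q')"
      using crossing_map_mem[of "P q'" "c q'" "c p" x] subspace_neg[OF subspace_normal_subspace]
      by (auto simp: G_def mem_Times_iff)
    ultimately obtain u where u: "u \<in> direction (P p)" "- G q' x = L q' u" by (metis imageE)
    have "m / 2 * norm u < m / 2 * (1 - norm (x - c p))"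
      using low[OF u(1)] small(2) u(2) by (metis norm_minus_cancel order.strict_trans1)
    then have "norm u < 1 - norm (x - c p)" using m(1) by simp
    then have "norm (x + u - c p) < 1"
      using norm_triangle_ineq[of "x - c p" u] by (simp add: algebra_simps)
    moreover have "G q' (x + u) - G q' x = L q' u"
      using crossing_map_diff[of "P q'" "c q'" "c p" "x + u" x] by (simp add: G_def L_def)
    then have "G q' (x + u) = 0" by (simp flip: u(2))
    moreover have "x + u \<in> P p" by (rule plane_add_direction[OF affine_P[OF p] xP(1) u(1)])
    ultimately show ?thesis
      unfolding crosses_def crossing_point_iff_crossing_map[OF affine_P[OF q'(1)] centre_mem_P[OF q'(1)]]
      by (auto simp: G_def)
  qed (use cr in simp)
  then show ?thesis using that e(1) by blast
qed

section \<open>Fibres that cross a given fibre exist nearby\<close>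

text \<open>
  The orthogonal complement at \<open>p\<close> of the tangent space of the fibre of \<open>p\<close>.
\<close>
definition slice :: "'a \<Rightarrow> 'a set" where
  "slice p = span (insert (p - c p) (normal_subspace (P p)))"

lemma linear_normal_part: "linear (normal_part p)"
  by (rule linear_closest_point_subspace[OF subspace_normal_subspace])

lemma normal_part_mem: "normal_part p v \<in> normal_subspace (P p)"
  by (rule closest_point_subspace_mem[OF subspace_normal_subspace])

lemma normal_part_idem: "v \<in> normal_subspace (P p) \<Longrightarrow> normal_part p v = v"
  by (rule closest_point_self)

lemma normal_part_own_radius:
  assumes "p \<in> E"
  shows "normal_part p (p - c p) = 0"
  using mem_plane_iff_closest_point_normal[OF affine_P[OF assms] centre_mem_P[OF assms], of p]
    mem_own_plane[OF assms] by simp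

lemma radius_orthogonal_normal:
  assumes "p \<in> E" "z \<in> normal_subspace (P p)"
  shows "(p - c p) \<bullet> z = 0"
  using closest_point_subspace_orthogonal[OF subspace_normal_subspace assms(2), of "p - c p"]
    normal_part_own_radius[OF assms(1)] by simp

lemma slice_decomp:
  assumes p: "p \<in> E" and w: "w \<in> slice p"
  shows "w = (w \<bullet> (p - c p)) *\<^sub>R (p - c p) + normal_part p w"
    and "(norm w)\<^sup>2 = (w \<bullet> (p - c p))\<^sup>2 + (norm (normal_part p w))\<^sup>2"
proof -
  interpret N: linear "normal_part p" by (rule linear_normal_part)
  have sp: "span (normal_subspace (P p)) = normal_subspace (P p)"
    by (simp add: span_eq_iff subspace_normal_subspace)
  obtain a where a: "w - a *\<^sub>R (p - c p) \<in> normal_subspace (P p)"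
    using w unfolding slice_def span_insert sp by blast
  define z where "z = w - a *\<^sub>R (p - c p)"
  have z: "z \<in> normal_subspace (P p)" using a by (simp add: z_def)
  have wz: "w = a *\<^sub>R (p - c p) + z" by (simp add: z_def)
  have u: "(p - c p) \<bullet> (p - c p) = 1" using norm_own_centre[OF p] by (simp add: dot_square_norm)
  have "w \<bullet> (p - c p) = a"
    unfolding wz inner_add_left inner_scaleR_left u
    using radius_orthogonal_normal[OF p z] by (simp add: inner_commute)
  moreover have "normal_part p w = z"
    unfolding wz N.add N.scale normal_part_own_radius[OF p] normal_part_idem[OF z] by simp
  ultimately show eq: "w = (w \<bullet> (p - c p)) *\<^sub>R (p - c p) + normal_part p w"
    using wz by simp
  have "(norm ((w \<bullet> (p - c p)) *\<^sub>R (p - c p) + normal_part p w))\<^sup>2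
      = (norm ((w \<bullet> (p - c p)) *\<^sub>R (p - c p)))\<^sup>2 + (norm (normal_part p w))\<^sup>2"
    by (rule norm_add_Pythagorean)
      (simp add: orthogonal_def radius_orthogonal_normal[OF p normal_part_mem])
  then show "(norm w)\<^sup>2 = (w \<bullet> (p - c p))\<^sup>2 + (norm (normal_part p w))\<^sup>2"
    using eq norm_own_centre[OF p] by (simp add: power_mult_distrib)
qed

text \<open>
  Besides \<open>p\<close>, the slice meets the fibre only in the antipode of \<open>p\<close>, at distance 2.
\<close>
lemma slice_meets_fibre:
  assumes p: "p \<in> E" and w: "w \<in> slice p" "norm w < 2" and mem: "p + w \<in> fibre p"
  shows "w = 0"
proof -
  interpret N: linear "normal_part p" by (rule linear_normal_part)
  have pw: "p + w \<in> P p" "norm (p + w - c p) = 1" using mem by (auto simp: fibre_def)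
  have "normal_part p (p + w - p) = 0"
    using mem_plane_iff_closest_point_normal[OF affine_P[OF p] mem_own_plane[OF p]] pw(1) by blast
  then have wa: "w = (w \<bullet> (p - c p)) *\<^sub>R (p - c p)"
    using slice_decomp(1)[OF p w(1)] by simp
  define a where "a = w \<bullet> (p - c p)"
  have wa: "w = a *\<^sub>R (p - c p)" using wa by (simp add: a_def)
  have "p + w - c p = (1 + a) *\<^sub>R (p - c p)" by (subst wa) (simp add: algebra_simps)
  then have "\<bar>1 + a\<bar> = 1" using pw(2) norm_own_centre[OF p] by simp
  moreover have "\<bar>a\<bar> < 2" using w(2) norm_own_centre[OF p] by (subst (asm) wa) simp
  ultimately have "a = 0" by linarith
  then show ?thesis using wa by simp
qed

text \<open>
  The homotopy of the introduction is spread over the disc of radius \<open>\<epsilon>\<close> in the slice: for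
  \<open>|w|\<close> between \<open>\<epsilon> / 2\<close> and \<open>\<epsilon>\<close> the affine map of the fibres of \<open>p\<close> and \<open>p + w\<close> is evaluated at the point \<open>x w\<close>
  that moves from the centre to \<open>p\<close>.  For smaller \<open>|w|\<close> the point stays at the centre, where
  the first component is at least 0, and a positive term is added to it, so that no zero occurs there.
  Identifying the target with the slice makes the resulting map \<open>f\<close> close to the identity on
  the boundary, and so \<open>f\<close> has a zero.
\<close>
lemma fibre_near_slice_crosses:
  assumes p: "p \<in> E" and \<delta>: "\<delta> > 0"
  obtains w where "w \<in> slice p" "w \<noteq> 0" "norm w \<le> \<delta>" "p + w \<in> E" "crosses p (p + w)"
proof -
  interpret N: linear "normal_part q" for q by (rule linear_normal_part)
  define u0 where "u0 = p - c p"
  have u0: "norm u0 = 1" "u0 \<bullet> u0 = 1" "normal_part p u0 = 0"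
    using norm_own_centre[OF p] normal_part_own_radius[OF p] by (simp_all add: u0_def dot_square_norm)
  have u0N: "z \<bullet> u0 = 0" if "z \<in> normal_subspace (P p)" for z
    using radius_orthogonal_normal[OF p that] by (simp add: u0_def inner_commute)
  define \<omega> where "\<omega> q = (\<Sum>b\<in>Basis. norm (normal_part q b - normal_part p b))" for q
  have \<omega>: "norm (normal_part q u - normal_part p u) \<le> norm u * \<omega> q" for q u
    unfolding \<omega>_def by (rule norm_linear_diff_le[OF linear_normal_part linear_normal_part])
  have "continuous_on E \<omega>"
    unfolding \<omega>_def by (intro continuous_intros continuous_normal)
  then have "isCont \<omega> p" using open_E p by (simp add: continuous_on_eq_continuous_at)
  then have "(\<omega> \<longlongrightarrow> 0) (nhds p)" by (simp add: tendsto_nhds_iff isCont_def \<omega>_def)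
  then have ev1: "\<forall>\<^sub>F q in nhds p. \<omega> q < 1/4" by (rule order_tendstoD) simp
  have "isCont c p" using continuous_centre open_E p by (simp add: continuous_on_eq_continuous_at)
  then have "(c \<longlongrightarrow> c p) (nhds p)" by (simp add: tendsto_nhds_iff isCont_def)
  then have ev2: "\<forall>\<^sub>F q in nhds p. dist (c q) (c p) < 1/4" by (rule tendstoD) simp
  have ev3: "\<forall>\<^sub>F q in nhds p. q \<in> E" using open_E p by (rule eventually_nhds_in_open)
  have "\<forall>\<^sub>F q in nhds p. \<omega> q < 1/4 \<and> dist (c q) (c p) < 1/4 \<and> q \<in> E"
    by (intro eventually_conj ev1 ev2 ev3)
  then obtain d where d: "d > 0"
    "\<And>q. dist q p < d \<Longrightarrow> \<omega> q < 1/4 \<and> dist (c q) (c p) < 1/4 \<and> q \<in> E"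
    by (auto simp: eventually_nhds_metric)
  \<comment> \<open>The bounds 1/4 leave a positive multiple of \<open>|w|\<^sup>2\<close> in the estimate of \<open>f w \<bullet> w\<close> below.\<close>
  define \<epsilon> where "\<epsilon> = min (min \<delta> (d / 2)) (1/4)"
  have \<epsilon>: "\<epsilon> > 0" "\<epsilon> \<le> \<delta>" "\<epsilon> < d" "\<epsilon> \<le> 1/4" using \<delta> d(1) by (auto simp: \<epsilon>_def)
  have near: "\<omega> (p + w) < 1/4" "norm (c (p + w) - c p) < 1/4" "p + w \<in> E" if "norm w \<le> \<epsilon>" for w
    using d(2)[of "p + w"] that \<epsilon>(3) by (auto simp: dist_norm)
  define s where "s w = max 0 (2 * norm w / \<epsilon> - 1)" for w :: 'a
  define x where "x w = c p + s w *\<^sub>R u0" for w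
  \<comment> \<open>\<open>A\<close> and \<open>Y\<close> are the components of the affine map of the fibres of \<open>p\<close> and \<open>p + w\<close> at
    \<open>x w\<close>, with the extra term in \<open>A\<close>.  The second projection in \<open>f\<close> makes the target
    independent of \<open>w\<close>; the factor \<open>-1/2\<close> makes \<open>f\<close> agree with the identity to first order.\<close>
  define A where
    "A w = (norm (x w - c (p + w)))\<^sup>2 - (s w)\<^sup>2 + max 0 (\<epsilon> - 2 * norm w)" for w
  define Y where "Y w = normal_part (p + w) (x w - c (p + w))" for w
  define f where "f w = (- (1/2) * A w) *\<^sub>R u0 - normal_part p (Y w)" for w
  have sub: "subspace (slice p)" by (simp add: slice_def)
  have in_slice: "u0 \<in> slice p" "z \<in> normal_subspace (P p) \<Longrightarrow> z \<in> slice p" for z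
    by (auto simp: slice_def u0_def intro: span_base)
  obtain w where w: "w \<in> slice p" "norm w \<le> \<epsilon>" "f w = 0"
  proof (rule poincare_bohl_subspace[OF sub \<epsilon>(1), of f])
    let ?K = "cball 0 \<epsilon> \<inter> slice p"
    have sh: "continuous_on ?K (\<lambda>w. p + w)" "(\<lambda>w. p + w) ` ?K \<subseteq> E"
      using near(3) by (auto intro!: continuous_intros)
    have cc: "continuous_on ?K (\<lambda>w. c (p + w))"
      by (rule continuous_on_compose2[OF continuous_centre sh])
    have cs: "continuous_on ?K s" unfolding s_def by (intro continuous_intros)  (use \<epsilon> in auto)
    have cx: "continuous_on ?K x" unfolding x_def by (intro continuous_intros cs)
    have cA: "continuous_on ?K A" unfolding A_def by (intro continuous_intros cs cc cx)
    have "continuous_on ?K (\<lambda>w. normal_part (p + w) v)" for v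
      by (rule continuous_on_compose2[OF continuous_normal sh])
    then have cY: "continuous_on ?K Y"
      unfolding Y_def
      by (rule continuous_on_closest_point_subspaces[OF subspace_normal_subspace])
        (intro continuous_on_diff cx cc)
    have "continuous_on ?K (\<lambda>w. normal_part p (Y w))"
      by (rule linear_continuous_on_compose[OF cY linear_normal_part])
    then show "continuous_on ?K f"
      unfolding f_def
      by (intro continuous_on_diff continuous_on_scaleR continuous_on_mult continuous_on_const cA)
    show "f w \<in> slice p" for w
      unfolding f_def
      by (intro subspace_diff[OF sub] subspace_scale[OF sub] in_slice normal_part_mem)
    fix w assume w: "w \<in> slice p" "norm w = \<epsilon>"
    let ?q = "p + w"
    have q: "?q \<in> E" "\<omega> ?q < 1/4" "norm (c ?q - c p) < 1/4" using near[of w] w(2) by auto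
    have sw: "s w = 1" using w(2) \<epsilon>(1) by (simp add: s_def)
    have xw: "x w = p" by (simp add: x_def sw u0_def)
    define r where "r = ?q - c ?q"
    have r: "norm r = 1" "normal_part ?q r = 0"
      using norm_own_centre[OF q(1)] normal_part_own_radius[OF q(1)] by (simp_all add: r_def)
    have pc: "p - c ?q = r - w" by (simp add: r_def)
    have Aw: "A w = (norm w)\<^sup>2 - 2 * (r \<bullet> w)"
    proof -
      have "(norm (r - w))\<^sup>2 = (norm r)\<^sup>2 + (norm w)\<^sup>2 - 2 * (r \<bullet> w)"
        by (simp add: power2_norm_eq_inner inner_diff_left inner_diff_right inner_commute)
      then show ?thesis using w(2) \<epsilon>(1) by (simp add: A_def xw pc sw r(1))
    qed
    have Yw: "Y w = - normal_part ?q w"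
      by (simp add: Y_def xw pc N.diff r(2))
    have "normal_part p (Y w) \<bullet> w = Y w \<bullet> normal_part p w"
      using inner_closest_point_subspace[OF subspace_normal_subspace, of w "P p" "Y w"]
        inner_closest_point_subspace[OF subspace_normal_subspace, of "Y w" "P p" w]
      by (simp add: inner_commute)
    then have fw: "f w \<bullet> w = (r \<bullet> w - (norm w)\<^sup>2 / 2) * (u0 \<bullet> w)
        + normal_part ?q w \<bullet> normal_part p w"
      by (simp add: f_def Aw Yw inner_diff_left algebra_simps)
    have rw: "r = u0 + (w - (c ?q - c p))" by (simp add: r_def u0_def)
    have np: "norm (normal_part p w) \<le> norm w"
      by (rule power2_le_imp_le) (simp_all add: slice_decomp(2)[OF p w(1)])
    have uw: "\<bar>u0 \<bullet> w\<bar> \<le> norm w" using Cauchy_Schwarz_ineq2[of u0 w] u0(1) by simp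
    have e1: "\<bar>(normal_part ?q w - normal_part p w) \<bullet> normal_part p w\<bar> \<le> (1/4) * (norm w)\<^sup>2"
    proof -
      have "norm (normal_part ?q w - normal_part p w) \<le> norm w * (1/4)"
        using \<omega>[of ?q w] q(2) by (meson less_imp_le mult_left_mono norm_ge_zero order_trans)
      then have "norm (normal_part ?q w - normal_part p w) * norm (normal_part p w)
          \<le> (norm w * (1/4)) * norm w"
        using np by (intro mult_mono) auto
      then show ?thesis
        using Cauchy_Schwarz_ineq2[of "normal_part ?q w - normal_part p w" "normal_part p w"]
        by (simp add: power2_eq_square)
    qed
    have e2: "\<bar>(w - (c ?q - c p)) \<bullet> w - (norm w)\<^sup>2 / 2\<bar> \<le> (3/8) * norm w"
    proof -
      have "(w - (c ?q - c p)) \<bullet> w - (norm w)\<^sup>2 / 2 = (norm w)\<^sup>2 / 2 - (c ?q - c p) \<bullet> w"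
        by (simp add: inner_diff_left dot_square_norm)
      moreover have "\<bar>(c ?q - c p) \<bullet> w\<bar> \<le> (1/4) * norm w"
        using Cauchy_Schwarz_ineq2[of "c ?q - c p" w] q(3)
        by (meson less_imp_le mult_right_mono norm_ge_zero order_trans)
      moreover have "(norm w)\<^sup>2 / 2 \<le> (1/8) * norm w"
        using w(2) \<epsilon>(4) \<epsilon>(1) by (simp add: power2_eq_square)
      moreover have "0 \<le> (norm w)\<^sup>2 / 2" by simp
      ultimately show ?thesis by linarith
    qed
    have e3: "\<bar>((w - (c ?q - c p)) \<bullet> w - (norm w)\<^sup>2 / 2) * (u0 \<bullet> w)\<bar> \<le> (3/8) * (norm w)\<^sup>2"
      using mult_mono[OF e2 uw] by (simp add: abs_mult power2_eq_square)
    have sq: "(u0 \<bullet> w)\<^sup>2 + (norm (normal_part p w))\<^sup>2 = (norm w)\<^sup>2"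
      by (simp add: slice_decomp(2)[OF p w(1)] u0_def inner_commute)
    have "f w \<bullet> w = (u0 \<bullet> w)\<^sup>2 + (norm (normal_part p w))\<^sup>2
        + ((w - (c ?q - c p)) \<bullet> w - (norm w)\<^sup>2 / 2) * (u0 \<bullet> w)
        + (normal_part ?q w - normal_part p w) \<bullet> normal_part p w"
      unfolding fw
      by (subst rw) (simp add: inner_add_left inner_diff_left dot_square_norm power2_eq_square algebra_simps)
    also have "\<dots> \<ge> (norm w)\<^sup>2 - (3/8) * (norm w)\<^sup>2 - (1/4) * (norm w)\<^sup>2"
      using e1 e3 sq by linarith
    finally have "f w \<bullet> w \<ge> (3/8) * (norm w)\<^sup>2" by simp
    moreover have "(norm w)\<^sup>2 > 0" using w(2) \<epsilon>(1) by simp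
    ultimately show "f w \<bullet> w > 0" by linarith
  qed (use that in blast)
  let ?q = "p + w"
  have q: "?q \<in> E" "\<omega> ?q < 1/4" using near[OF w(2)] by auto
  have "0 = f w \<bullet> u0" using w(3) by simp
  also have "\<dots> = - (1/2) * A w"
    using u0N[OF normal_part_mem[of p "Y w"]] by (simp add: f_def inner_diff_left u0(2))
  finally have A0: "A w = 0" by simp
  then have npY: "normal_part p (Y w) = 0" using w(3) by (simp add: f_def)
  \<comment> \<open>The projection to the normal space at \<open>p\<close> is injective on the nearby normal space at \<open>p + w\<close>.\<close>
  have Y0: "Y w = 0"
  proof -
    have "normal_part ?q (Y w) = Y w"
      unfolding Y_def by (rule normal_part_idem[OF normal_part_mem])
    then have "norm (Y w) \<le> norm (Y w) * \<omega> ?q" using \<omega>[of ?q "Y w"] npY by simp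
    also have "\<dots> \<le> norm (Y w) * (1/4)" using q(2) by (intro mult_left_mono) auto
    finally show ?thesis by simp
  qed
  have big: "\<epsilon> \<le> 2 * norm w"
  proof (rule ccontr)
    assume "\<not> ?thesis"
    then have "s w = 0" "max 0 (\<epsilon> - 2 * norm w) > 0" using \<epsilon>(1) by (auto simp: s_def)
    then have "A w > 0" unfolding A_def by (simp add: add_nonneg_pos)
    then show False using A0 by simp
  qed
  have w0: "w \<noteq> 0" using big \<epsilon>(1) by auto
  have s01: "0 \<le> s w" "s w \<le> 1" using w(2) \<epsilon>(1) by (auto simp: s_def divide_le_eq)
  have "(norm (x w - c ?q))\<^sup>2 = (s w)\<^sup>2" using A0 big by (simp add: A_def)
  then have nq: "norm (x w - c ?q) = s w" using s01(1) by (simp add: power2_eq_iff_nonneg)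
  have np: "norm (x w - c p) = s w" using u0(1) s01(1) by (simp add: x_def)
  have xP: "x w \<in> P p"
    using mem_plane_iff_closest_point_normal[OF affine_P[OF p] centre_mem_P[OF p], of "x w"]
    by (simp add: x_def N.scale u0(3))
  have xq: "x w \<in> P ?q"
    using mem_plane_iff_closest_point_normal[OF affine_P[OF q(1)] centre_mem_P[OF q(1)], of "x w"] Y0
    by (simp add: Y_def)
  have "s w \<noteq> 1"
  proof
    assume "s w = 1"
    then have "x w \<in> fibre p" "x w \<in> fibre ?q" using xP xq np nq by (auto simp: fibre_def)
    then have "?q \<in> fibre p" using fibres_meet_imp[OF p q(1)] by blast
    then show False using slice_meets_fibre[OF p w(1)] w(2) \<epsilon>(4) w0 by simp
  qed
  then have "crosses p ?q"
    unfolding crosses_def crossing_point_def using xP xq np nq s01 by (intro exI[of _ "x w"]) auto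
  then show ?thesis using that w w0 q(1) \<epsilon>(2) by force
qed

lemma dim_slice:
  assumes p: "p \<in> E" and dim: "DIM('a) = 2 * n + 1"
  shows "dim (slice p) = n + 1"
proof -
  have sp: "span (normal_subspace (P p)) = normal_subspace (P p)"
    by (simp add: span_eq_iff subspace_normal_subspace)
  have "p - c p \<notin> normal_subspace (P p)"
    using radius_orthogonal_normal[OF p] norm_own_centre[OF p] by fastforce
  then have "dim (slice p) = dim (normal_subspace (P p)) + 1"
    unfolding slice_def by (simp add: dim_insert sp)
  moreover have "P p \<noteq> {}" using centre_mem_P[OF p] by blast
  ultimately show ?thesis
    using dim_normal_subspace[OF affine_P[OF p]] dim_direction_sphere(2)[OF is_unit_sphere_fibre[OF p]] dim
    by simp
qed

section \<open>All nearby fibres cross\<close>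

text \<open>
  The slice has dimension \<open>n + 1 \<ge> 2\<close>, so its punctured balls are connected, and in them the crossing
  condition is open, closed and somewhere true.
\<close>
lemma punctured_slice_crosses:
  assumes dim: "DIM('a) = 2 * n + 1" and n: "n \<noteq> 0" and p: "p \<in> E"
    and r: "0 < r" "r < 2" "ball p r \<subseteq> E" and w: "w \<in> slice p" "norm w < r"
  shows "crosses p (p + w)"
proof (cases "w = 0")
  case True
  then show ?thesis using crosses_own_fibre[OF p self_mem_fibre[OF p]] by simp
next
  case w0: False
  define W where "W = ball 0 r \<inter> slice p - {0}"
  define X where "X = (+) p ` W"
  have sub: "subspace (slice p)" by (simp add: slice_def)
  have "X \<subseteq> ball p r" by (auto simp: X_def W_def dist_norm)
  then have XE: "X \<subseteq> E" using r(3) by (rule subset_trans)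
  have conn: "connected X"
  proof -
    have ne: "slice p \<inter> ball 0 r \<noteq> {}"
      using subspace_0[OF sub] r(1) by (auto simp: disjoint_iff intro!: exI[of _ 0])
    have "aff_dim (slice p \<inter> ball 0 r) = int (n + 1)"
      using aff_dim_convex_Int_open[OF subspace_imp_convex[OF sub] open_ball ne]
        aff_dim_subspace[OF sub] dim_slice[OF p dim] by simp
    then have "aff_dim (ball 0 r \<inter> slice p) = int (n + 1)" by (simp only: Int_commute)
    then have "connected W"
      unfolding W_def using n
      by (intro connected_punctured_convex convex_Int subspace_imp_convex[OF sub]) auto
    then show ?thesis unfolding X_def by (intro connected_continuous_image continuous_intros)
  qed
  define C where "C = {q \<in> X. crosses p q}"
  obtain D where D: "closed D" "{q \<in> E. crosses p q} = E \<inter> D"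
    using closedin_crosses[OF p] unfolding closedin_closed by blast
  have "C = X \<inter> D" using XE D(2) by (auto simp: C_def)
  then have "closedin (top_of_set X) C" using D(1) by (simp add: closedin_closed_Int)
  moreover have "openin (top_of_set X) C"
    unfolding openin_euclidean_subtopology_iff
  proof (intro conjI ballI)
    fix q assume q: "q \<in> C"
    then obtain v where "v \<in> W" and qv: "q = p + v" by (auto simp: C_def X_def)
    then have v: "v \<in> slice p" "norm v < r" "v \<noteq> 0" "q = p + v" by (simp_all add: W_def)
    have "q \<notin> fibre p" using slice_meets_fibre[OF p v(1)] v r(2) by auto
    then obtain e where "e > 0" "\<And>q'. q' \<in> E \<Longrightarrow> dist q' q < e \<Longrightarrow> crosses p q'"
      using crosses_stable[OF dim p, of q] q XE by (auto simp: C_def)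
    then show "\<exists>e>0. \<forall>q'\<in>X. dist q' q < e \<longrightarrow> q' \<in> C" using XE by (auto simp: C_def)
  qed (auto simp: C_def)
  moreover have "C \<noteq> {}"
  proof -
    obtain v where "v \<in> slice p" "v \<noteq> 0" "norm v \<le> r / 2" "crosses p (p + v)"
      using fibre_near_slice_crosses[OF p, of "r / 2"] r(1) by auto
    then have "p + v \<in> C" using r(1) by (auto simp: C_def X_def W_def)
    then show ?thesis by blast
  qed
  ultimately have "C = X" using conn by (auto simp: connected_clopen)
  moreover have "p + w \<in> X" using w w0 by (auto simp: X_def W_def)
  ultimately show ?thesis by (auto simp: C_def)
qed

text \<open>
  A point \<open>q\<close> near the fibre lies in the slice at \<open>p'\<close>, the nearest point of the fibre, which
  is obtained by normalising the component of \<open>q - c p\<close> along the plane.  For \<open>n = 0\<close> the slice is a line and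
  punctured intervals are disconnected, but then the plane is everything and the midpoint of the centres
  is a crossing point.
\<close>
lemma near_fibre_crosses:
  assumes dim: "DIM('a) = 2 * n + 1" and p: "p \<in> E" and q0: "q0 \<in> fibre p"
  obtains e where "e > 0" "\<And>q. q \<in> E \<Longrightarrow> dist q q0 < e \<Longrightarrow> crosses p q"
proof (cases "n = 0")
  case True
  have UNIV: "P q = UNIV" if "q \<in> E" for q
  proof -
    have "aff_dim (P q) = int (DIM('a))"
      using is_unit_sphere_fibre[OF that] dim True by (simp add: is_unit_sphere_def)
    then show ?thesis using affine_P[OF that] by (simp add: aff_dim_eq_full affine_hull_eq[THEN iffD2])
  qed
  have q0E: "q0 \<in> E" using fibre_subset[OF p] q0 by blast
  then have "isCont c q0" using continuous_centre open_E by (simp add: continuous_on_eq_continuous_at)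
  then obtain e where e: "e > 0" "\<And>q. dist q q0 < e \<Longrightarrow> dist (c q) (c q0) < 1"
    unfolding continuous_at_eps_delta by (metis zero_less_one)
  have "crosses p q" if "q \<in> E" "dist q q0 < e" for q
  proof -
    have "dist (c q) (c p) < 1" using e(2)[OF that(2)] fibre_mem_eq(3)[OF p q0] by simp
    then show ?thesis
      unfolding crosses_def crossing_point_def UNIV[OF p] UNIV[OF that(1)]
      by (intro exI[of _ "midpoint (c p) (c q)"])
        (simp add: dist_midpoint flip: dist_norm, simp add: dist_commute)
  qed
  then show ?thesis using that e(1) by blast
next
  case False
  have q0E: "q0 \<in> E" using fibre_subset[OF p] q0 by blast
  then obtain R where R: "R > 0" "ball q0 R \<subseteq> E" using open_E open_contains_ball by blast
  define e where "e = min (R / 6) (1/2)"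
  have e: "e > 0" "e \<le> R / 6" "e \<le> 1/2" using R(1) by (auto simp: e_def)
  have "crosses p q" if q: "q \<in> E" "dist q q0 < e" for q
  proof -
    define z where "z = normal_part p (q - c p)"
    define y where "y = q - c p - z"
    interpret N: linear "normal_part p" by (rule linear_normal_part)
    have zN: "z \<in> normal_subspace (P p)" unfolding z_def by (rule normal_part_mem)
    have y0: "normal_part p y = 0"
      unfolding y_def N.diff[of "q - c p"] normal_part_idem[OF zN] z_def[symmetric] by simp
    define v where "v = q0 - c p"
    have v: "norm v = 1" "normal_part p v = 0"
      using q0 mem_plane_iff_closest_point_normal[OF affine_P[OF p] centre_mem_P[OF p], of q0]
      by (auto simp: fibre_def v_def)
    have "q - q0 = (y - v) + z" by (simp add: y_def v_def)
    moreover have "orthogonal (y - v) z"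
      using closest_point_subspace_orthogonal[OF subspace_normal_subspace zN, of "y - v"] y0 v(2)
      by (simp add: N.diff orthogonal_def)
    ultimately have sq: "(dist q q0)\<^sup>2 = (norm (y - v))\<^sup>2 + (norm z)\<^sup>2"
      by (simp only: dist_norm norm_add_Pythagorean)
    have yv: "norm (y - v) \<le> dist q q0" and zd: "norm z \<le> dist q q0"
      by (rule power2_le_imp_le; simp add: sq)+
    have ny: "\<bar>norm y - 1\<bar> \<le> dist q q0"
      using norm_triangle_ineq3[of y v] yv v(1) by linarith
    then have ypos: "norm y > 0" using q(2) e(3) by linarith
    define p' where "p' = c p + (1 / norm y) *\<^sub>R y"
    have p'f: "p' \<in> fibre p"
      using mem_plane_iff_closest_point_normal[OF affine_P[OF p] centre_mem_P[OF p], of p'] ypos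
      by (simp add: fibre_def p'_def N.scale y0)
    have p'E: "p' \<in> E" using p'f fibre_subset[OF p] by blast
    note same = fibre_mem_eq[OF p p'f]
    define w where "w = q - p'"
    have wdec: "w = (norm y - 1) *\<^sub>R (p' - c p') + z"
    proof -
      have "p' - c p' = (1 / norm y) *\<^sub>R y" unfolding same(3) by (simp add: p'_def)
      then have "(norm y - 1) *\<^sub>R (p' - c p') = y - (1 / norm y) *\<^sub>R y"
        using ypos by (simp add: scaleR_left_diff_distrib diff_divide_distrib)
      then show ?thesis by (simp add: w_def p'_def y_def)
    qed
    have w: "w \<in> slice p'"
      unfolding wdec slice_def same(2) using zN
      by (intro span_add span_scale) (auto intro: span_base)
    have "norm w \<le> \<bar>norm y - 1\<bar> * norm (p' - c p') + norm z"
      unfolding wdec by (metis norm_scaleR norm_triangle_ineq)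
    then have nw: "norm w \<le> 2 * dist q q0"
      using ny zd norm_own_centre[OF p'E] by simp
    have "dist p' q0 \<le> 3 * dist q q0"
      using nw dist_triangle[of p' q0 q] by (simp add: w_def dist_norm norm_minus_commute)
    then have "ball p' (2 * e) \<subseteq> ball q0 R"
      using e(1,2) q(2) by (simp add: ball_subset_ball_iff)
    then have "ball p' (2 * e) \<subseteq> E" using R(2) by (rule subset_trans)
    then have "crosses p' (p' + w)"
      by (intro punctured_slice_crosses[OF dim False p'E _ _ _ w, of "2 * e"])
        (use e nw q(2) in auto)
    then show ?thesis unfolding crosses_def same by (simp add: w_def)
  qed
  then show ?thesis using that e(1) by blast
qed

section \<open>The dimension bound and linking\<close>

lemma double_dim_bound:
  assumes "E \<noteq> {}"
  shows "DIM('a) \<ge> 2 * n + 1"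
proof -
  obtain p where p: "p \<in> E" using assms by blast
  obtain w where w: "w \<in> slice p" "w \<noteq> 0" "norm w \<le> 1" "p + w \<in> E" "crosses p (p + w)"
    using fibre_near_slice_crosses[OF p, of 1] by auto
  have "p + w \<notin> fibre p" using slice_meets_fibre[OF p w(1)] w(2,3) by auto
  then have "fibre p \<inter> fibre (p + w) = {}" using fibres_meet_imp[OF p w(4)] by blast
  moreover obtain x where "crossing_point (P p) (c p) (P (p + w)) (c (p + w)) x"
    using w(5) by (auto simp: crosses_def)
  ultimately show ?thesis
    using crossing_dim(1) inj_on_crossing_linear is_unit_sphere_fibre[OF p] is_unit_sphere_fibre[OF w(4)]
    by blast
qed

text \<open>
  Planes and centres are constant along fibres, so the crossing condition for \<open>q\<close> depends only on the fibre of \<open>q\<close>, and the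
  open sets of points where it holds and where it fails are unions of fibres.
\<close>
lemma crosses_in_component:
  assumes dim: "DIM('a) = 2 * n + 1" and p: "p \<in> E" and q: "q \<in> E"
    and comp: "connected_component_of (fibre_space F) (fibre p) (fibre q)"
  shows "crosses p q"
proof -
  have sat: "crosses p q' \<longleftrightarrow> crosses p q" if "q \<in> E" "q' \<in> fibre q" for q q'
    unfolding crosses_def fibre_mem_eq[OF that] ..
  define U where "U = {fibre q | q. q \<in> E \<and> crosses p q}"
  define V where "V = {fibre q | q. q \<in> E \<and> \<not> crosses p q}"
  have UF: "U \<subseteq> F" and VF: "V \<subseteq> F" using fibre_mem_F by (auto simp: U_def V_def)
  have UU: "\<Union>U = {q \<in> E. crosses p q}" and VV: "\<Union>V = {q \<in> E. \<not> crosses p q}"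
    using self_mem_fibre fibre_subset sat unfolding U_def V_def by blast+
  have "open (\<Union>U)"
    unfolding open_dist
  proof
    fix q assume "q \<in> \<Union>U"
    then have q: "q \<in> E" "crosses p q" by (auto simp: UU)
    obtain e where e: "e > 0" "\<And>q'. q' \<in> E \<Longrightarrow> dist q' q < e \<Longrightarrow> crosses p q'"
      using near_fibre_crosses[OF dim p] crosses_stable[OF dim p q(1) _ q(2)] by blast
    obtain e' where e': "e' > 0" "\<And>q'. dist q' q < e' \<Longrightarrow> q' \<in> E"
      using open_E q(1) unfolding open_dist by blast
    show "\<exists>e>0. \<forall>y. dist y q < e \<longrightarrow> y \<in> \<Union>U"
      unfolding UU using e e' by (intro exI[of _ "min e e'"]) auto
  qed
  moreover have "open (\<Union>V)"
  proof -
    have "openin (top_of_set E) (E - {q \<in> E. crosses p q})"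
      using closedin_crosses[OF p] by (simp add: closedin_def)
    moreover have "E - {q \<in> E. crosses p q} = \<Union>V" by (auto simp: VV)
    ultimately show ?thesis using open_E openin_open_trans by metis
  qed
  ultimately have op: "openin (fibre_space F) U" "openin (fibre_space F) V"
    using UF VF by (simp_all add: openin_fibre_space[OF disjoint_F])
  obtain K where K: "connectedin (fibre_space F) K" "fibre p \<in> K" "fibre q \<in> K"
    using comp unfolding connected_component_of_def by blast
  have "topspace (fibre_space F) \<subseteq> F"
    using openin_fibre_space[OF disjoint_F, of "topspace (fibre_space F)"] by simp
  then have "K \<subseteq> F" using connectedin_subset_topspace[OF K(1)] by (rule subset_trans[rotated])
  moreover have "F \<subseteq> U \<union> V"
  proof
    fix S assume S: "S \<in> F"
    have "S \<noteq> {}" using S nonempty_F by metis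
    then obtain q where "q \<in> S" by blast
    then show "S \<in> U \<union> V" using S fibre_eq[OF S] Union_F unfolding U_def V_def by blast
  qed
  ultimately have KUV: "K \<subseteq> U \<union> V" by blast
  have "U \<inter> V = {}"
  proof (rule equals0I)
    fix S assume "S \<in> U \<inter> V"
    then obtain q where "q \<in> E" "crosses p q" "q \<in> \<Union>V"
      using self_mem_fibre by (auto simp: U_def)
    then show False by (simp add: VV)
  qed
  then have disj: "U \<inter> V \<inter> K = {}" by simp
  have "fibre p \<in> U"
    using crosses_own_fibre[OF p self_mem_fibre[OF p]] p by (auto simp: U_def)
  then have "U \<inter> K \<noteq> {}" using K(2) by blast
  then have "V \<inter> K = {}"
    using connectedinD[OF K(1) op KUV disj] by blast
  then have "fibre q \<in> U" using K(3) KUV by blast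
  then show ?thesis using self_mem_fibre[OF q] UU by blast
qed

lemma linked_in_component:
  assumes dim: "DIM('a) = 2 * n + 1" and ST: "S \<in> F" "T \<in> F" "S \<noteq> T"
    and comp: "connected_component_of (fibre_space F) S T"
  shows "linked n S T"
proof -
  have "S \<noteq> {}" "T \<noteq> {}" using nonempty_F ST by metis+
  then obtain p q where pq: "p \<in> S" "q \<in> T" by blast
  then have E: "p \<in> E" "q \<in> E" using ST Union_F by blast+
  have eq: "S = fibre p" "T = fibre q" using fibre_eq pq ST by blast+
  obtain x where x: "crossing_point (P p) (c p) (P q) (c q) x"
    using crosses_in_component[OF dim E] comp unfolding eq crosses_def by blast
  have "S \<inter> T = {}" using disjoint_F ST by (auto simp: pairwise_def disjnt_def)
  then have "S retract_of - T"
    using crossing_imp_retract[OF _ _ _ x dim] is_unit_sphere_fibre[OF E(1)] is_unit_sphere_fibre[OF E(2)]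
    unfolding eq by blast
  then show ?thesis
    using linked_if_retract is_unit_sphere_fibre[OF E(1)] is_unit_sphere_fibre[OF E(2)]
    unfolding eq by blast
qed

end

theorem lemma2p2:
  fixes n :: nat and E :: "'a::euclidean_space set" and F :: "'a set set"
  assumes "E \<noteq> {}"
    and "unit_sphere_fibration n E F"
  shows "DIM('a) \<ge> 2 * n + 1 \<and>
         (DIM('a) = 2 * n + 1 \<longrightarrow>
            (\<forall>S\<in>F. \<forall>T\<in>F. S \<noteq> T \<and> connected_component_of (fibre_space F) S T \<longrightarrow> linked n S T))"
proof -
  obtain P c where Pc: "\<forall>S\<in>F. \<forall>p\<in>S. is_unit_sphere n (P p) (c p) S" "continuous_on E c"
      "continuous_subspaces_on E (\<lambda>p. normal_subspace (P p))"
    using assms(2) unfolding unit_sphere_fibration_def by blast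
  interpret parametrized_sphere_fibration n E F P c
    using assms(2) Pc empty_not_fibre[OF assms(2)]
    by unfold_locales (auto simp: unit_sphere_fibration_def continuous_subspaces_on_def)
  show ?thesis using double_dim_bound[OF assms(1)] linked_in_component by blast
qed

end
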